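(* Let $f$ be a transcendental meromorphic function on $\mathbb{C}$ with a non-zero Picard exceptional value, and let $k$ be a positive integer. If $f f^{(k)}$ is a periodic function, then $f$ is also a periodic function.
   Context: Meromorphic means meromorphic in the whole complex plane $\mathbb{C}$; transcendental means not a rational function. A non-zero Picard exceptional value of $f$ is a value $\eta\in\mathbb{C}\setminus\{0\}$ that $f$ does not take in $\mathbb{C}$. A meromorphic function $h$ is periodic if there is a constant $c\in\mathbb{C}\setminus\{0\}$ with $h(z+c)\equiv h(z)$; such $c$ is called a period. $f^{(k)}$ denotes the $k$-th derivative of $f$. *)

theory Defs
  imports "HOL-Complex_Analysis.Complex_Analysis"
begin

text \<open>
  Meromorphic functions on the complex plane are total functions of type
  \<open>complex \<Rightarrow> complex\<close>, so their values (and those of their derivatives) at poles are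
  conventional. An identity between meromorphic functions is therefore read as an identity
  outside a closed discrete set, written with the quantifier \<open>\<forall>\<^sub>\<approx>z\<close>.
\<close>

definition rational_meromorphic :: "(complex \<Rightarrow> complex) \<Rightarrow> bool" where
  "rational_meromorphic f \<longleftrightarrow>
     (\<exists>p q :: complex poly. q \<noteq> 0 \<and> (\<forall>\<^sub>\<approx>z. f z = poly p z / poly q z))"

text \<open>
  \<open>nicely_meromorphic_on\<close> is the normal form of a meromorphic function: removable
  singularities are filled in, and the value at a pole is set to 0.
\<close>
definition transcendental_meromorphic :: "(complex \<Rightarrow> complex) \<Rightarrow> bool" where
  "transcendental_meromorphic f \<longleftrightarrow>
     f nicely_meromorphic_on UNIV \<and> \<not> rational_meromorphic f"

text \<open>The conventional value at a pole does not count as a value taken by the function.\<close>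
definition picard_exceptional_value :: "(complex \<Rightarrow> complex) \<Rightarrow> complex \<Rightarrow> bool" where
  "picard_exceptional_value f \<eta> \<longleftrightarrow> (\<forall>z. \<not> is_pole f z \<longrightarrow> f z \<noteq> \<eta>)"

definition periodic_meromorphic :: "(complex \<Rightarrow> complex) \<Rightarrow> bool" where
  "periodic_meromorphic h \<longleftrightarrow> (\<exists>c. c \<noteq> 0 \<and> (\<forall>\<^sub>\<approx>z. h (z + c) = h z))"

text \<open>For functions in normal form the periodicity identity holds at every point.\<close>
lemma periodic_meromorphic_iff_pointwise:
  assumes "f nicely_meromorphic_on UNIV"
  shows "periodic_meromorphic f \<longleftrightarrow> (\<exists>c. c \<noteq> 0 \<and> (\<forall>z. f (z + c) = f z))"
proof -
  have "f (z + c) = f z" if ev: "\<forall>\<^sub>\<approx>z. f (z + c) = f z" for c z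
  proof -
    have ev': "eventually (\<lambda>w. f (w + c) = f w) (at z)"
      using ev by (simp add: eventually_cosparse_open_eq)
    have nice: "is_pole f w \<and> f w = 0 \<or> f \<midarrow>w\<rightarrow> f w" for w
      using assms by (auto simp: nicely_meromorphic_on_def)
    have lim: "f \<midarrow>z+c\<rightarrow> l \<longleftrightarrow> f \<midarrow>z\<rightarrow> l" for l
    proof -
      have "f \<midarrow>z+c\<rightarrow> l \<longleftrightarrow> (\<lambda>w. f (w + c)) \<midarrow>z\<rightarrow> l"
        using LIM_offset[of f l "z + c" c] LIM_offset[of "\<lambda>w. f (w + c)" l z "- c"] by auto
      also have "\<dots> \<longleftrightarrow> f \<midarrow>z\<rightarrow> l"
        by (rule tendsto_cong) (rule ev')
      finally show ?thesis .
    qed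
    show ?thesis
      using nice[of z] nice[of "z + c"] lim LIM_unique[of f] not_tendsto_and_filterlim_at_infinity[of "at z" f]
        not_tendsto_and_filterlim_at_infinity[of "at (z + c)" f]
      unfolding is_pole_def by (metis at_neq_bot)
  qed
  thus ?thesis
    by (auto simp: periodic_meromorphic_def)
qed

end

theory Submission
  imports Defs "HOL-Real_Asymp.Real_Asymp"
begin

text \<open>
  Let \<open>c\<close> be a period of \<open>H = f f\<^sup>(\<^sup>k\<^sup>)\<close>. The translates \<open>f\<^sub>n z = f (z + n c)\<close> all omit the value \<open>\<eta>\<close> and all solve
  \<open>y y\<^sup>(\<^sup>k\<^sup>) = H\<close>. It is therefore enough to show that two of them coincide, and the argument depends on whether
  \<open>f\<close> has a pole.

  Suppose that \<open>f\<close> has a pole \<open>z0\<close>, of order \<open>p\<close>. A solution has the same poles as \<open>H\<close>, and \<open>H\<close> determines its order and,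
  up to sign, its leading coefficient there (\<open>pole_leading_coeff_determined\<close>). Hence two of \<open>f\<^sub>0\<close>, \<open>f\<^sub>1\<close>, \<open>f\<^sub>2\<close> have the same leading term.
  For even \<open>k\<close> this makes them equal. For odd \<open>k\<close> further solutions with the same leading
  term are conceivable; they would be told apart by the quadratic form
  \<open>Q y = \<Sum>j<k. (-1)\<^sup>j y\<^sup>(\<^sup>j\<^sup>) y\<^sup>(\<^sup>k\<^sup>-\<^sup>1\<^sup>-\<^sup>j\<^sup>)\<close>, a primitive of \<open>2 y y\<^sup>(\<^sup>k\<^sup>)\<close> (\<open>pole_rigidity\<close>). As all \<open>Q f\<^sub>n\<close> have the same
  derivative, \<open>Q f\<^sub>n = Q f + n C\<close> with a constant \<open>C\<close>. Here \<open>C = 0\<close>, because the \<open>f\<^sub>n\<close> are uniformly bounded on an annulus around \<open>z0\<close>: near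
  \<open>z0\<close> they omit 0 and \<open>\<eta>\<close>, so Schottky's theorem bounds each of them on the annulus by its value at a single point, and
  the common size of the leading coefficients provides a point where this value is under control
  (\<open>fn_bounded_on_annulus\<close>).

  Suppose now that \<open>f\<close> is entire. Then \<open>F = f - \<eta>\<close> and \<open>G = f\<^sub>1 - \<eta>\<close> have no zeros, so \<open>F = exp \<gamma>\<close>, \<open>G = exp \<delta>\<close>, and the
  quotients \<open>R = F\<^sup>(\<^sup>k\<^sup>) / F\<close> and \<open>S = G\<^sup>(\<^sup>k\<^sup>) / G\<close> are differential polynomials in \<open>\<gamma>\<close> and \<open>\<delta>\<close>. The relation
  \<open>(F + \<eta>) F R = (G + \<eta>) G S\<close> and its derivative allow the elimination of \<open>G\<close>, which leaves a polynomial equation for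
  \<open>F\<close> whose coefficients are differential polynomials in \<open>\<gamma>\<close> and \<open>\<delta>\<close>. Such coefficients are small: on suitable circles their logarithms
  are at most of the order of \<open>L\<close>, the logarithm of the maximum of \<open>\<bar>\<gamma>\<bar> + \<bar>\<delta>\<bar>\<close>, while the mean of the positive part of the real part of the larger of
  \<open>\<gamma>\<close>, \<open>\<delta>\<close> is at least of order \<open>exp L / L\<close>. By Jensen's inequality the exponential of that function is
  transcendental over the small functions (\<open>exp_transcendental_over_small\<close>). By symmetry it may be taken
  to be \<open>F\<close>. So the polynomial equation is trivial, which forces \<open>R = S\<close>
  (\<open>quadratic_relation_forces_equality\<close>), and then \<open>(F - G) (F + G + \<eta>) = 0\<close>. Picard's little theorem excludes the second factor, and \<open>F = G\<close> says
  that \<open>c\<close> is a period of \<open>f\<close>.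
\<close>

section \<open>Solutions of \<open>F F\<^sup>(\<^sup>k\<^sup>) = H\<close> in Laurent series\<close>

definition falling :: "int \<Rightarrow> nat \<Rightarrow> int" where
  "falling m k = (\<Prod>i<k. m - int i)"

lemma falling_0 [simp]: "falling m 0 = 1"
  by (simp add: falling_def)

lemma falling_Suc: "falling m (Suc k) = (m - int k) * falling m k"
  by (simp add: falling_def)

text \<open>
  The three sign lemmas together locate the integers \<open>m\<close> with
  \<open>falling m k = - falling (-p) k\<close>, which is the condition for a perturbation of order \<open>m\<close> of a
  solution with a pole of order \<open>p\<close>: none for even \<open>k\<close>, and only \<open>m \<ge> k\<close> for odd \<open>k\<close>.
\<close>
lemma falling_neg_sign:
  assumes "m < 0"
  shows "(-1) ^ k * falling m k > 0"
proof (induction k)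
  case (Suc k)
  have "(-1) ^ Suc k * falling m (Suc k) = (int k - m) * ((-1) ^ k * falling m k)"
    by (simp add: falling_Suc algebra_simps)
  with Suc assms show ?case by simp
qed simp

lemma falling_pos:
  assumes "m \<ge> int k"
  shows "falling m k > 0"
  unfolding falling_def by (rule prod_pos) (use assms in auto)

lemma falling_eq_0:
  assumes "0 \<le> m" "m < int k"
  shows "falling m k = 0"
proof -
  have "nat m \<in> {..<k}" using assms by auto
  moreover have "m - int (nat m) = 0" using assms by simp
  ultimately show ?thesis unfolding falling_def using prod_zero[of "{..<k}" "\<lambda>i. m - int i"] by blast
qed

text \<open>
  The coefficient \<open>a\<close> may be 0; this makes the predicate stable under sums, where leading terms can
  cancel, and under products and derivatives, where \<open>fls_subdegree\<close> would need case distinctions.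
\<close>
definition leading :: "complex fls \<Rightarrow> int \<Rightarrow> complex \<Rightarrow> bool" where
  "leading F m a \<longleftrightarrow> (\<forall>n<m. fls_nth F n = 0) \<and> fls_nth F m = a"

lemma leading_subdegree: "leading F (fls_subdegree F) (fls_nth F (fls_subdegree F))"
  by (simp add: leading_def)

lemma leading_imp_subdegree:
  assumes "leading F m a" "a \<noteq> 0"
  shows "fls_subdegree F = m"
  using assms unfolding leading_def by (intro fls_subdegree_eqI) auto

lemma leading_weaken: "leading F m a \<Longrightarrow> n < m \<Longrightarrow> leading F n 0"
  by (auto simp: leading_def)

lemma leading_add: "leading F m a \<Longrightarrow> leading G m b \<Longrightarrow> leading (F + G) m (a + b)"
  by (auto simp: leading_def)

lemma leading_diff: "leading F m a \<Longrightarrow> leading G m b \<Longrightarrow> leading (F - G) m (a - b)"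
  by (auto simp: leading_def)

lemma leading_zero_iff [simp]: "leading 0 m a \<longleftrightarrow> a = 0"
  by (auto simp: leading_def)

lemma leading_sum:
  assumes "\<And>i. i \<in> I \<Longrightarrow> leading (F i) m (a i)"
  shows "leading (sum F I) m (sum a I)"
  using assms by (induction I rule: infinite_finite_induct) (auto intro: leading_add)

lemma leading_mult:
  assumes "leading F m a" "leading G n b"
  shows "leading (F * G) (m + n) (a * b)"
proof (cases "F = 0 \<or> G = 0")
  case True
  with assms show ?thesis by auto
next
  case False
  have m: "m \<le> fls_subdegree F" and n: "n \<le> fls_subdegree G"
    using assms False by (auto simp: leading_def intro!: fls_subdegree_geI)
  have sub: "fls_subdegree (F * G) = fls_subdegree F + fls_subdegree G"
    using False by simp
  show ?thesis
  proof (cases "m = fls_subdegree F \<and> n = fls_subdegree G")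
    case True
    then show ?thesis using assms sub by (auto simp: leading_def)
  next
    case False
    then have lt: "m + n < fls_subdegree (F * G)" and z: "m < fls_subdegree F \<or> n < fls_subdegree G"
      using m n sub by linarith+
    then have "a * b = 0" using assms by (auto simp: leading_def)
    with lt show ?thesis by (auto simp: leading_def)
  qed
qed

lemma leading_power_neg1:
  "leading F m a \<Longrightarrow> leading ((-1) ^ j * F) m ((-1) ^ j * a)"
  by (cases "even j") (auto simp: leading_def)

lemma leading_deriv:
  assumes "leading F m a"
  shows "leading (fls_deriv F) (m - 1) (of_int m * a)"
  using assms unfolding leading_def by simp

lemma leading_higher_deriv:
  assumes "leading F m a"
  shows "leading ((fls_deriv ^^ k) F) (m - int k) (of_int (falling m k) * a)"
proof (induction k)
  case (Suc k)
  show ?case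
    using leading_deriv[OF Suc] by (simp add: falling_Suc algebra_simps)
qed (use assms in simp)

lemma fls_higher_deriv_add:
  "(fls_deriv ^^ k) (F + G) = (fls_deriv ^^ k) F + (fls_deriv ^^ k) (G :: complex fls)"
  by (induction k) simp_all

text \<open>
  Bilinear form with \<open>(alt_form k F G)' = F G\<^sup>(\<^sup>k\<^sup>) - (-1)\<^sup>k F\<^sup>(\<^sup>k\<^sup>) G\<close> by telescoping. For odd \<open>k\<close>
  the quadratic form \<open>alt_form k F F\<close> is thus a primitive of \<open>2 F F\<^sup>(\<^sup>k\<^sup>)\<close>.
\<close>
definition alt_form :: "nat \<Rightarrow> complex fls \<Rightarrow> complex fls \<Rightarrow> complex fls" where
  "alt_form k F G = (\<Sum>j<k. (-1) ^ j * ((fls_deriv ^^ j) F * (fls_deriv ^^ (k - 1 - j)) G))"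

lemma alt_form_add_left: "alt_form k (F + F') G = alt_form k F G + alt_form k F' G"
  by (simp add: alt_form_def fls_higher_deriv_add algebra_simps sum.distrib)

lemma alt_form_add_right: "alt_form k F (G + G') = alt_form k F G + alt_form k F G'"
  by (simp add: alt_form_def fls_higher_deriv_add algebra_simps sum.distrib)

lemma leading_alt_form:
  assumes "leading F m a" "leading G n b" "k > 0"
  shows "leading (alt_form k F G) (m + n - (int k - 1))
     (of_int (\<Sum>j<k. (-1) ^ j * falling m j * falling n (k - 1 - j)) * (a * b))"
proof -
  have "leading (alt_form k F G) (m + n - (int k - 1))
     (\<Sum>j<k. (-1) ^ j * ((of_int (falling m j) * a) * (of_int (falling n (k - 1 - j)) * b)))"
    unfolding alt_form_def
  proof (intro leading_sum leading_power_neg1)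
    fix j assume "j \<in> {..<k}"
    then have e: "m + n - (int k - 1) = (m - int j) + (n - int (k - 1 - j))"
      by auto
    show "leading ((fls_deriv ^^ j) F * (fls_deriv ^^ (k - 1 - j)) G) (m + n - (int k - 1))
       ((of_int (falling m j) * a) * (of_int (falling n (k - 1 - j)) * b))"
      unfolding e by (intro leading_mult leading_higher_deriv assms)
  qed
  moreover have "(\<Sum>j<k. (-1) ^ j * ((of_int (falling m j) * a) * (of_int (falling n (k - 1 - j)) * b)))
     = of_int (\<Sum>j<k. (-1) ^ j * falling m j * falling n (k - 1 - j)) * (a * b)"
    unfolding of_int_sum sum_distrib_right by (intro sum.cong refl) (simp add: mult_ac)
  ultimately show ?thesis by (simp only:)
qed

text \<open>
  The leading coefficient of \<open>G G\<^sup>(\<^sup>k\<^sup>)\<close> at a pole of order \<open>p\<close> is \<open>falling (-p) k\<close> times the square of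
  the leading coefficient of \<open>G\<close>, which leaves only a choice of sign. A regular \<open>G\<close> is impossible
  because \<open>G G\<^sup>(\<^sup>k\<^sup>)\<close> would be regular too.
\<close>
lemma pole_leading_coeff_determined:
  fixes F G :: "complex fls"
  assumes eq: "F * (fls_deriv ^^ k) F = G * (fls_deriv ^^ k) G"
    and F: "leading F (- int p) a" "a \<noteq> 0" "p > 0"
  shows "leading G (- int p) a \<or> leading G (- int p) (- a)"
proof -
  define q where "q = fls_subdegree G"
  define b where "b = fls_nth G q"
  have G: "leading G q b" using leading_subdegree[of G] by (simp add: q_def b_def)
  note LF = leading_mult[OF F(1) leading_higher_deriv[OF F(1), of k]]
  note LG = leading_mult[OF G leading_higher_deriv[OF G, of k]]
  have fp: "falling (- int p) k \<noteq> 0"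
    using falling_neg_sign[of "- int p" k] F(3) by auto
  have H: "fls_subdegree (F * (fls_deriv ^^ k) F) = - 2 * int p - int k"
    using leading_imp_subdegree[OF LF] fp F by simp
  have "G \<noteq> 0" 
  proof
    assume "G = 0"
    with eq have "F * (fls_deriv ^^ k) F = 0" by simp
    with LF have "a * (of_int (falling (- int p) k) * a) = 0" by simp
    with fp F show False by simp
  qed
  then have b: "b \<noteq> 0" by (simp add: b_def q_def)
  have q: "q < 0"
  proof (rule ccontr)
    assume "\<not> q < 0"
    have "\<forall>n<0. fls_nth ((fls_deriv ^^ k) G) n = 0"
    proof (induction k)
      case 0
      show ?case using \<open>\<not> q < 0\<close> unfolding q_def by auto
    next
      case (Suc k)
      show ?case
      proof safe
        fix n :: int assume "n < 0"
        then show "fls_nth ((fls_deriv ^^ Suc k) G) n = 0"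
          using Suc by (cases "n = -1") auto
      qed
    qed
    then have "leading ((fls_deriv ^^ k) G) 0 (fls_nth ((fls_deriv ^^ k) G) 0)"
      by (auto simp: leading_def)
    moreover have "leading G 0 (fls_nth G 0)"
      using \<open>\<not> q < 0\<close> unfolding q_def leading_def by auto
    ultimately have "leading (G * (fls_deriv ^^ k) G) (0 + 0) (fls_nth G 0 * fls_nth ((fls_deriv ^^ k) G) 0)"
      by (intro leading_mult)
    with eq have *: "\<forall>n<0. fls_nth (F * (fls_deriv ^^ k) F) n = 0" by (simp add: leading_def)
    have "- int p + (- int p - int k) < 0" using F by auto
    with * have "fls_nth (F * (fls_deriv ^^ k) F) (- int p + (- int p - int k)) = 0" by blast
    with LF have "a * (of_int (falling (- int p) k) * a) = 0" by (simp add: leading_def)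
    with F(2) fp show False by simp
  qed
  then have fq: "falling q k \<noteq> 0"
    using falling_neg_sign[of q k] by auto
  have "fls_subdegree (G * (fls_deriv ^^ k) G) = 2 * q - int k"
    using leading_imp_subdegree[OF LG] fq b by simp
  with H eq have qp: "q = - int p" by simp
  have "a * (of_int (falling (- int p) k) * a) = b * (of_int (falling (- int p) k) * b)"
    using LF LG eq qp by (simp add: leading_def)
  with fp have "a * a = b * b" by auto
  then have "b = a \<or> b = - a" by (auto simp: square_eq_iff)
  with G qp show ?thesis by auto
qed

text \<open>
  Suppose \<open>D = G - F \<noteq> 0\<close> starts with \<open>d t\<^sup>m\<close>, where \<open>m > -p\<close>. The lowest term of
  \<open>G G\<^sup>(\<^sup>k\<^sup>) - F F\<^sup>(\<^sup>k\<^sup>)\<close> then forces \<open>falling m k + falling (-p) k = 0\<close>. The signs rule this out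
  for even \<open>k\<close>. For odd \<open>k\<close> they leave a resonance with \<open>m \<ge> k\<close>, and there the lowest
  term of \<open>alt_form k G G - alt_form k F F\<close> is a sum of positive multiples of \<open>a d\<close>, so it
  cannot vanish.
\<close>
lemma pole_rigidity:
  fixes F G :: "complex fls"
  assumes eq: "F * (fls_deriv ^^ k) F = G * (fls_deriv ^^ k) G"
    and alt: "odd k \<Longrightarrow> alt_form k F F = alt_form k G G"
    and F: "leading F (- int p) a" "a \<noteq> 0" "p > 0" and G: "leading G (- int p) a" and k: "k > 0"
  shows "F = G"
proof (rule ccontr)
  assume "F \<noteq> G"
  define D where "D = G - F"
  define m where "m = fls_subdegree D"
  define d where "d = fls_nth D m"
  have D0: "D \<noteq> 0" using \<open>F \<noteq> G\<close> by (simp add: D_def)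
  then have d: "d \<noteq> 0" by (simp add: d_def m_def)
  have D: "leading D m d" using leading_subdegree[of D] by (simp add: m_def d_def)
  have GD: "G = F + D" by (simp add: D_def)
  have "leading D (- int p) (a - a)" unfolding D_def by (rule leading_diff[OF G F(1)])
  then have "\<forall>n \<le> - int p. fls_nth D n = 0" by (auto simp: leading_def order_le_less)
  then have m: "m > - int p" unfolding m_def using D0 fls_subdegree_greaterI by blast
  have "F * (fls_deriv ^^ k) D + D * (fls_deriv ^^ k) F + D * (fls_deriv ^^ k) D = 0"
    using eq by (simp add: GD fls_higher_deriv_add algebra_simps)
  moreover have "leading (F * (fls_deriv ^^ k) D + D * (fls_deriv ^^ k) F + D * (fls_deriv ^^ k) D)
      (m - int p - int k) (a * (of_int (falling m k) * d) + d * (of_int (falling (- int p) k) * a) + 0)"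
  proof (intro leading_add)
    show "leading (F * (fls_deriv ^^ k) D) (m - int p - int k) (a * (of_int (falling m k) * d))"
      using leading_mult[OF F(1) leading_higher_deriv[OF D, of k]] by (simp add: algebra_simps)
    show "leading (D * (fls_deriv ^^ k) F) (m - int p - int k) (d * (of_int (falling (- int p) k) * a))"
      using leading_mult[OF D leading_higher_deriv[OF F(1), of k]] by (simp add: algebra_simps)
    show "leading (D * (fls_deriv ^^ k) D) (m - int p - int k) 0"
      by (rule leading_weaken[OF leading_mult[OF D leading_higher_deriv[OF D, of k]]]) (use m in simp)
  qed
  ultimately have "(of_int (falling m k + falling (- int p) k)) * (a * d) = 0"
    by (simp add: algebra_simps)
  then have sum0: "falling m k + falling (- int p) k = 0"
    using d F(2) by (metis mult_eq_0_iff of_int_eq_0_iff)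
  have neg: "(-1) ^ k * falling (- int p) k > 0"
    by (rule falling_neg_sign) (use F in simp)
  have "m \<ge> 0"
  proof (rule ccontr)
    assume "\<not> m \<ge> 0"
    then have "(-1) ^ k * falling m k > 0" by (intro falling_neg_sign) simp
    with neg have "(-1) ^ k * (falling m k + falling (- int p) k) > 0"
      by (simp add: algebra_simps)
    with sum0 show False by simp
  qed
  then have mk: "m \<ge> int k"
    using falling_eq_0[of m k] sum0 neg by (cases "m < int k") auto
  have "falling m k > 0" using mk by (rule falling_pos)
  with sum0 neg have odd: "odd k" by (cases "even k") auto
  have "alt_form k F D + alt_form k D F + alt_form k D D = 0"
    using alt[OF odd] unfolding GD by (simp add: alt_form_add_left alt_form_add_right algebra_simps)
  moreover define S T where 
    "S = (\<Sum>j<k. (-1) ^ j * falling (- int p) j * falling m (k - 1 - j))" and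
    "T = (\<Sum>j<k. (-1) ^ j * falling m j * falling (- int p) (k - 1 - j))"
  have "leading (alt_form k F D + alt_form k D F + alt_form k D D)
     (m - int p - (int k - 1)) (of_int S * (a * d) + of_int T * (d * a) + 0)"
  proof (intro leading_add)
    show "leading (alt_form k F D) (m - int p - (int k - 1)) (of_int S * (a * d))"
      using leading_alt_form[OF F(1) D k] unfolding S_def by (simp add: algebra_simps)
    show "leading (alt_form k D F) (m - int p - (int k - 1)) (of_int T * (d * a))"
      using leading_alt_form[OF D F(1) k] unfolding T_def by (simp add: algebra_simps)
    show "leading (alt_form k D D) (m - int p - (int k - 1)) 0"
      by (rule leading_weaken[OF leading_alt_form[OF D D k]]) (use m in simp)
  qed
  ultimately have "of_int (S + T) * (a * d) = 0"
    by (simp add: algebra_simps)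
  then have "S + T = 0"
    using d F(2) by (metis mult_eq_0_iff of_int_eq_0_iff)
  moreover have "S > 0" unfolding S_def
  proof (rule sum_pos)
    fix j assume "j \<in> {..<k}"
    then have "falling m (k - 1 - j) > 0" using mk by (intro falling_pos) auto
    moreover have "(-1) ^ j * falling (- int p) j > 0" using F by (intro falling_neg_sign) simp
    ultimately show "(-1) ^ j * falling (- int p) j * falling m (k - 1 - j) > 0" by simp
  qed (use k in auto)
  moreover have "T > 0" unfolding T_def
  proof (rule sum_pos)
    fix j assume j: "j \<in> {..<k}"
    then have "falling m j > 0" using mk by (intro falling_pos) auto
    moreover have "(-1) ^ (k - 1 - j) * falling (- int p) (k - 1 - j) > 0" using F by (intro falling_neg_sign) simp
    moreover have "(-1::int) ^ (k - 1 - j) = (-1) ^ j"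
      using odd j by (auto simp: minus_one_power_iff)
    ultimately have "0 < falling m j * ((-1) ^ j * falling (- int p) (k - 1 - j))" by simp
    then show "(-1) ^ j * falling m j * falling (- int p) (k - 1 - j) > 0" by (simp add: mult_ac)
  qed (use k in auto)
  ultimately show False by simp
qed

section \<open>Zero-free functions in punctured discs\<close>

text \<open>
  The map \<open>s \<mapsto> z0 + (w - z0) exp s\<close> never takes the value \<open>z0\<close>, and each point of the annulus around the
  circle of radius \<open>\<sigma>\<close> has a preimage at distance at most 5 from the origin. Since \<open>\<sigma> exp 10 \<le> \<rho>\<close>,
  the disc of radius 9 is mapped into the punctured disc, and one application of Schottky's theorem
  on that disc, at ratio 5/9, bounds \<open>h\<close> on the whole annulus by its value at the single point \<open>w\<close>.
\<close>
lemma punctured_disc_Schottky: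
  fixes h :: "complex \<Rightarrow> complex"
  assumes hol: "h holomorphic_on ball z0 \<rho> - {z0}"
    and omit: "\<And>z. z \<in> ball z0 \<rho> - {z0} \<Longrightarrow> h z \<noteq> 0 \<and> h z \<noteq> 1"
    and \<sigma>: "\<sigma> > 0" "\<sigma> * exp 10 \<le> \<rho>"
    and w: "norm (w - z0) = \<sigma>" "norm (h w) \<le> r"
    and z: "\<sigma> * exp (-1) \<le> norm (z - z0)" "norm (z - z0) \<le> \<sigma> * exp 1"
  shows "norm (h z) \<le> exp (pi * exp (pi * (17 + 2 * r)))"
proof -
  define e where "e s = z0 + (w - z0) * exp (9 * s)" for s
  define \<xi> where "\<xi> = Ln ((z - z0) / (w - z0))"
  have nz: "w - z0 \<noteq> 0" using w \<sigma> by auto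
  have "0 < \<sigma> * exp (-1)" using \<sigma> by simp
  with z(1) have nz': "z - z0 \<noteq> 0" by (metis norm_zero not_less)
  have e_in: "e s \<in> ball z0 \<rho> - {z0}" if "s \<in> cball 0 1" for s
  proof -
    have "Re (9 * s) \<le> 9" using that complex_Re_le_cmod[of s] by simp
    then have "norm (e s - z0) \<le> \<sigma> * exp 9"
      using w(1) \<sigma> by (simp add: e_def norm_mult)
    also have "\<dots> < \<sigma> * exp 10" using \<sigma> by simp
    finally have "norm (e s - z0) < \<rho>" using \<sigma> by simp
    moreover have "e s \<noteq> z0" using nz by (simp add: e_def)
    ultimately show ?thesis by (simp add: dist_norm norm_minus_commute)
  qed
  have "exp \<xi> = (z - z0) / (w - z0)" using nz nz' by (simp add: \<xi>_def)
  then have e\<xi>: "e (\<xi> / 9) = z" using nz by (simp add: e_def)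
  have "\<bar>Re \<xi>\<bar> \<le> 1"
  proof -
    have "Re \<xi> = ln (norm ((z - z0) / (w - z0)))"
      unfolding \<xi>_def using nz nz' by (intro Re_Ln) simp
    also have "\<dots> = ln (norm (z - z0) / \<sigma>)" by (simp add: norm_divide w)
    finally have R: "Re \<xi> = ln (norm (z - z0) / \<sigma>)" .
    have q: "exp (-1) \<le> norm (z - z0) / \<sigma>" "norm (z - z0) / \<sigma> \<le> exp 1"
      using z \<sigma> by (simp_all add: field_simps)
    have "ln (exp (-1)) \<le> ln (norm (z - z0) / \<sigma>)"
      by (rule ln_mono) (use q nz' \<sigma> in auto)
    moreover have "ln (norm (z - z0) / \<sigma>) \<le> ln (exp 1)"
      by (rule ln_mono) (use q nz' \<sigma> in auto)
    ultimately show ?thesis using R by simp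
  qed
  moreover have "\<bar>Im \<xi>\<bar> \<le> 4"
    using Im_Ln_le_pi[of "(z - z0) / (w - z0)"] mpi_less_Im_Ln[of "(z - z0) / (w - z0)"] nz nz' pi_less_4
    unfolding \<xi>_def by (auto simp: abs_le_iff)
  ultimately have "norm \<xi> \<le> 5" using cmod_le[of \<xi>] by linarith
  then have n: "norm (\<xi> / 9) \<le> 5 / 9" by (simp add: norm_divide)
  have "norm ((h \<circ> e) (\<xi> / 9)) \<le> exp (pi * exp (pi * (2 + 2 * r + 12 * (5/9) / (1 - 5/9))))"
  proof (rule Schottky[where f = "h \<circ> e" and z = "\<xi> / 9" and t = "5/9" and r = r])
    show "h \<circ> e holomorphic_on cball 0 1"
    proof (rule holomorphic_on_compose_gen[OF _ hol])
      show "e holomorphic_on cball 0 1" unfolding e_def by (intro holomorphic_intros)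
      show "e ` cball 0 1 \<subseteq> ball z0 \<rho> - {z0}" using e_in by blast
    qed
    show "norm ((h \<circ> e) 0) \<le> r" using w by (simp add: e_def)
    show "\<not> ((h \<circ> e) s = 0 \<or> (h \<circ> e) s = 1)" if "s \<in> cball 0 1" for s
      using omit[OF e_in[OF that]] by simp
  qed (use n in auto)
  then show ?thesis using e\<xi> by (simp add: algebra_simps)
qed

text \<open>
  The function \<open>(z - z0)\<^sup>p f z\<close> has no zero in the disc and takes the value \<open>a\<close> at the centre, so by the
  maximum principle for its reciprocal, its modulus is at most that of \<open>a\<close> somewhere on the circle.
\<close>
lemma pole_small_value_on_circle:
  fixes f :: "complex \<Rightarrow> complex"
  assumes hol: "f holomorphic_on ball z0 \<rho> - {z0}"
    and nz: "\<And>z. z \<in> ball z0 \<rho> - {z0} \<Longrightarrow> f z \<noteq> 0"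
    and F: "(\<lambda>w. f (z0 + w)) has_laurent_expansion F"
    and lead: "leading F (- int p) a" and a: "a \<noteq> 0"
    and \<sigma>: "0 < \<sigma>" "\<sigma> < \<rho>"
  shows "\<exists>w. norm (w - z0) = \<sigma> \<and> norm (f w) \<le> norm a / \<sigma> ^ p"
proof -
  define u where "u z = (if z = z0 then inverse a else inverse (f z * (z - z0) ^ p))" for z
  have "(\<lambda>w. f (z0 + w) * w powi int p) has_laurent_expansion fls_shift (- int p) F"
    by (intro laurent_expansion_intros F)
  then have E: "(\<lambda>w. f (z0 + w) * ((z0 + w) - z0) ^ p) has_laurent_expansion fls_shift (- int p) F"
    by simp
  have "fls_subdegree (fls_shift (- int p) F) = 0"
    using lead a by (intro fls_subdegree_eqI) (auto simp: leading_def)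
  with has_laurent_expansion_imp_tendsto[of "\<lambda>z. f z * (z - z0) ^ p", OF E] lead
  have "((\<lambda>z. f z * (z - z0) ^ p) \<longlongrightarrow> a) (at z0)" by (simp add: leading_def)
  then have "((\<lambda>z. inverse (f z * (z - z0) ^ p)) \<longlongrightarrow> inverse a) (at z0)"
    using a by (intro tendsto_inverse)
  then have "(u \<longlongrightarrow> inverse a) (at z0)"
    by (rule Lim_transform_eventually) (auto simp: u_def eventually_at_filter)
  then have lim: "(u \<longlongrightarrow> u z0) (at z0)" by (simp add: u_def)
  have "u holomorphic_on ball z0 \<rho>"
  proof (rule no_isolated_singularity'[where K = "{z0}"])
    show "(u \<longlongrightarrow> u z) (at z within ball z0 \<rho>)" if "z \<in> {z0}" for z
      using that tendsto_within_subset[OF lim] by auto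
    have "(\<lambda>z. inverse (f z * (z - z0) ^ p)) holomorphic_on ball z0 \<rho> - {z0}"
      by (intro holomorphic_intros hol) (use nz in auto)
    then show "u holomorphic_on ball z0 \<rho> - {z0}"
      by (rule holomorphic_transform) (auto simp: u_def)
  qed auto
  then have hu: "u holomorphic_on cball z0 \<sigma>"
    by (rule holomorphic_on_subset) (use \<sigma> in auto)
  have "compact (sphere z0 \<sigma>)" "sphere z0 \<sigma> \<noteq> {}" using \<sigma> by auto
  moreover have "continuous_on (sphere z0 \<sigma>) (\<lambda>z. norm (u z))"
    by (intro continuous_intros holomorphic_on_imp_continuous_on holomorphic_on_subset[OF hu]) auto
  ultimately obtain w where w: "w \<in> sphere z0 \<sigma>" "\<And>y. y \<in> sphere z0 \<sigma> \<Longrightarrow> norm (u y) \<le> norm (u w)"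
    using continuous_attains_sup[of "sphere z0 \<sigma>"] by blast
  have "norm (u z0) \<le> norm (u w)"
  proof (rule maximum_modulus_frontier[where f = u and \<xi> = z0 and S = "cball z0 \<sigma>"])
    show "u holomorphic_on interior (cball z0 \<sigma>)"
      by (rule holomorphic_on_subset[OF hu]) (simp add: interior_subset)
    show "continuous_on (closure (cball z0 \<sigma>)) u"
      using hu by (simp add: holomorphic_on_imp_continuous_on)
  qed (use w \<sigma> in auto)
  moreover have wz: "w \<noteq> z0" "norm (w - z0) = \<sigma>"
    using w \<sigma> by (auto simp: dist_norm norm_minus_commute)
  ultimately have "inverse (norm a) \<le> inverse (norm (f w) * \<sigma> ^ p)"
    by (simp add: u_def norm_inverse norm_mult norm_power)
  moreover have "norm (f w) * \<sigma> ^ p > 0"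
    using nz[of w] w \<sigma> wz by auto
  ultimately have "norm (f w) * \<sigma> ^ p \<le> norm a"
    using a by (simp add: le_imp_inverse_le inverse_le_imp_le)
  then show ?thesis using wz \<sigma> by (intro exI[of _ w]) (simp add: field_simps)
qed

section \<open>Translation and Laurent expansion of higher derivatives\<close>

lemma deriv_shift:
  fixes f :: "complex \<Rightarrow> complex"
  shows "deriv (\<lambda>z. f (z + c)) = (\<lambda>z. deriv f (z + c))"
  by (auto simp: deriv_def DERIV_shift[symmetric] fun_eq_iff)

lemma higher_deriv_shift:
  fixes f :: "complex \<Rightarrow> complex"
  shows "(deriv ^^ k) (\<lambda>z. f (z + c)) = (\<lambda>z. (deriv ^^ k) f (z + c))"
  by (induction k) (simp_all add: deriv_shift)

lemma eventually_at_shift: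
  fixes z c :: complex
  shows "eventually P (at (z + c)) \<longleftrightarrow> eventually (\<lambda>w. P (w + c)) (at z)"
  by (subst (1 2) eventually_at_to_0) (simp add: add.assoc)

lemma laurent_higher_deriv:
  assumes "(\<lambda>w. f (z0 + w)) has_laurent_expansion F"
  shows "(\<lambda>w. (deriv ^^ k) f (z0 + w)) has_laurent_expansion (fls_deriv ^^ k) F"
proof (induction k)
  case (Suc k)
  have "deriv (\<lambda>w. (deriv ^^ k) f (w + z0)) has_laurent_expansion fls_deriv ((fls_deriv ^^ k) F)"
    using Suc by (intro laurent_expansion_intros) (simp add: add.commute)
  then show ?case by (simp add: deriv_shift add.commute)
qed (use assms in simp)

definition alt_form_fun :: "nat \<Rightarrow> (complex \<Rightarrow> complex) \<Rightarrow> complex \<Rightarrow> complex" where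
  "alt_form_fun k f z = (\<Sum>j<k. (-1) ^ j * ((deriv ^^ j) f z * (deriv ^^ (k - 1 - j)) f z))"

lemma laurent_alt_form:
  assumes "(\<lambda>w. f (z0 + w)) has_laurent_expansion F"
  shows "(\<lambda>w. alt_form_fun k f (z0 + w)) has_laurent_expansion alt_form k F F"
  unfolding alt_form_fun_def alt_form_def
proof (intro has_laurent_expansion_sum)
  fix j
  have "(\<lambda>w. (deriv ^^ j) f (z0 + w) * (deriv ^^ (k - 1 - j)) f (z0 + w)) has_laurent_expansion
     (fls_deriv ^^ j) F * (fls_deriv ^^ (k - 1 - j)) F"
    by (intro has_laurent_expansion_mult laurent_higher_deriv assms)
  then show "(\<lambda>w. (-1) ^ j * ((deriv ^^ j) f (z0 + w) * (deriv ^^ (k - 1 - j)) f (z0 + w))) has_laurent_expansion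
     (-1) ^ j * ((fls_deriv ^^ j) F * (fls_deriv ^^ (k - 1 - j)) F)"
    by (cases "even j") (auto intro: has_laurent_expansion_minus)
qed

text \<open>
  With \<open>t j = (-1)\<^sup>j f\<^sup>(\<^sup>j\<^sup>) f\<^sup>(\<^sup>k\<^sup>-\<^sup>j\<^sup>)\<close>, the derivative of the \<open>j\<close>-th summand is \<open>t j - t (j + 1)\<close>, so
  the sum telescopes to \<open>t 0 - t k\<close>; for odd \<open>k\<close> the two terms add up.
\<close>
lemma DERIV_alt_form_fun:
  assumes f: "f analytic_on {z}" and k: "odd k"
  shows "(alt_form_fun k f has_field_derivative 2 * (f z * (deriv ^^ k) f z)) (at z)"
proof -
  define t where "t j = (-1) ^ j * ((deriv ^^ j) f z * (deriv ^^ (k - j)) f z)" for j :: nat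
  have D: "((deriv ^^ j) f has_field_derivative (deriv ^^ Suc j) f z) (at z)" for j
    using analytic_higher_deriv[OF f, of j] by (auto simp: analytic_derivI)
  have "(alt_form_fun k f has_field_derivative (\<Sum>j<k. t j - t (Suc j))) (at z)"
    unfolding alt_form_fun_def
  proof (rule DERIV_sum)
    fix j assume "j \<in> {..<k}"
    then have s: "Suc (k - 1 - j) = k - j" "k - Suc j = k - 1 - j" by auto
    show "((\<lambda>z. (-1) ^ j * ((deriv ^^ j) f z * (deriv ^^ (k - 1 - j)) f z)) has_field_derivative
        t j - t (Suc j)) (at z)"
      by (rule derivative_eq_intros D refl)+ (unfold s t_def, simp add: algebra_simps)
  qed
  moreover have "(\<Sum>j<k. t j - t (Suc j)) = t 0 - t k" by (rule sum_lessThan_telescope')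
  moreover have "t 0 - t k = 2 * (f z * (deriv ^^ k) f z)"
    using k by (simp add: t_def)
  ultimately show ?thesis by simp
qed

section \<open>Translates near a pole\<close>

lemma pole_leading:
  assumes "(\<lambda>w. f (z0 + w)) has_laurent_expansion F" "is_pole f z0"
  obtains p a where "leading F (- int p) a" "a \<noteq> 0" "p > 0"
proof -
  have "fls_subdegree F < 0" using has_laurent_expansion_imp_is_pole_iff assms by blast
  moreover from this have "F \<noteq> 0" by auto
  ultimately show ?thesis
    using that[of "nat (- fls_subdegree F)" "fls_nth F (fls_subdegree F)"] leading_subdegree[of F] by simp
qed

lemma leading_pole:
  assumes "(\<lambda>w. f (z0 + w)) has_laurent_expansion F" "leading F (- int p) a" "a \<noteq> 0" "p > 0"
  shows "is_pole f z0"
  using assms leading_imp_subdegree[OF assms(2,3)] by (intro has_laurent_expansion_imp_is_pole) auto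

lemma laurent_product_eq:
  assumes F: "(\<lambda>w. f (z0 + w)) has_laurent_expansion F" and G: "(\<lambda>w. g (z0 + w)) has_laurent_expansion G"
    and ev: "eventually (\<lambda>z. g z * (deriv ^^ k) g z = f z * (deriv ^^ k) f z) (at z0)"
  shows "F * (fls_deriv ^^ k) F = G * (fls_deriv ^^ k) G"
proof (rule has_laurent_expansion_unique)
  show "(\<lambda>w. f (z0 + w) * (deriv ^^ k) f (z0 + w)) has_laurent_expansion F * (fls_deriv ^^ k) F"
    by (intro laurent_expansion_intros laurent_higher_deriv F)
  have "(\<lambda>w. g (z0 + w) * (deriv ^^ k) g (z0 + w)) has_laurent_expansion G * (fls_deriv ^^ k) G"
    by (intro laurent_expansion_intros laurent_higher_deriv G)
  moreover have ev': "eventually (\<lambda>w. g (z0 + w) * (deriv ^^ k) g (z0 + w) = f (z0 + w) * (deriv ^^ k) f (z0 + w)) (at 0)"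
    using ev by (subst (asm) eventually_at_to_0) (simp add: add.commute)
  ultimately show "(\<lambda>w. f (z0 + w) * (deriv ^^ k) f (z0 + w)) has_laurent_expansion G * (fls_deriv ^^ k) G"
    using has_laurent_expansion_cong[OF ev' refl] by simp
qed

lemma pole_transfer:
  assumes "f meromorphic_on {z0}" "g meromorphic_on {z0}"
    and ev: "eventually (\<lambda>z. g z * (deriv ^^ k) g z = f z * (deriv ^^ k) f z) (at z0)"
    and pole: "is_pole f z0"
  shows "is_pole g z0"
proof -
  obtain F where F: "(\<lambda>w. f (z0 + w)) has_laurent_expansion F"
    using assms by (auto simp: meromorphic_on_def)
  obtain G where G: "(\<lambda>w. g (z0 + w)) has_laurent_expansion G"
    using assms by (auto simp: meromorphic_on_def)
  obtain p a where pa: "leading F (- int p) a" "a \<noteq> 0" "p > 0" using pole_leading[OF F pole] .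
  have "leading G (- int p) a \<or> leading G (- int p) (- a)"
    by (rule pole_leading_coeff_determined[OF laurent_product_eq[OF F G ev] pa])
  then show ?thesis using leading_pole[OF G _ _ pa(3)] pa(2) by fastforce
qed

text \<open>
  The translates \<open>fn n\<close> of \<open>f\<close> by multiples of the period \<open>c\<close> all omit \<open>\<eta>\<close>, and by periodicity they are all
  solutions \<open>y\<close> of the same equation \<open>y y\<^sup>(\<^sup>k\<^sup>) = H\<close>. To prove that \<open>f\<close> is periodic it suffices that two of
  them coincide.
\<close>
locale periodic_product =
  fixes f :: "complex \<Rightarrow> complex" and k :: nat and c \<eta> :: complex
  assumes nice: "f nicely_meromorphic_on UNIV" and k: "k > 0" and c: "c \<noteq> 0" and \<eta>: "\<eta> \<noteq> 0"
    and omit: "\<And>z. \<not> is_pole f z \<Longrightarrow> f z \<noteq> \<eta>"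
    and period: "\<forall>\<^sub>\<approx>z. f (z + c) * (deriv ^^ k) f (z + c) = f z * (deriv ^^ k) f z"
begin

definition H where "H z = f z * (deriv ^^ k) f z"

definition fn :: "nat \<Rightarrow> complex \<Rightarrow> complex" where "fn n z = f (z + of_nat n * c)"

lemma fn_0 [simp]: "fn 0 = f" by (simp add: fn_def fun_eq_iff)

lemma mero: "f meromorphic_on A"
  using nice meromorphic_on_subset by (auto simp: nicely_meromorphic_on_def)

lemma higher_deriv_fn: "(deriv ^^ k) (fn n) = (\<lambda>z. (deriv ^^ k) f (z + of_nat n * c))"
  unfolding fn_def by (rule higher_deriv_shift)

lemma period_fn: "eventually (\<lambda>z. fn n z * (deriv ^^ k) (fn n) z = f z * (deriv ^^ k) f z) (at z)"
proof (induction n arbitrary: z)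
  case (Suc n)
  have "eventually (\<lambda>w. H (w + c) = H w) (at (z + of_nat n * c))"
    using period by (auto simp: eventually_cosparse_open_eq H_def)
  then have "eventually (\<lambda>w. H (w + of_nat n * c + c) = H (w + of_nat n * c)) (at z)"
    by (simp add: eventually_at_shift)
  moreover have "eventually (\<lambda>w. H (w + of_nat n * c) = H w) (at z)"
    using Suc[of z] unfolding higher_deriv_fn by (simp add: H_def fn_def)
  ultimately have "eventually (\<lambda>w. H (w + of_nat (Suc n) * c) = H w) (at z)"
    by eventually_elim (simp add: algebra_simps)
  then show ?case unfolding higher_deriv_fn by (simp add: H_def fn_def)
qed (simp add: fn_def)

lemma mero_fn: "fn n meromorphic_on {z}"
proof -
  obtain F where "(\<lambda>w. f ((z + of_nat n * c) + w)) has_laurent_expansion F"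
    using mero[of UNIV] by (auto simp: meromorphic_on_def)
  then have "(\<lambda>w. fn n (z + w)) has_laurent_expansion F"
    by (simp add: fn_def algebra_simps)
  then show ?thesis by (auto simp: meromorphic_on_def)
qed

text \<open>
  The poles of a solution are exactly the poles of \<open>H\<close>, so all translates share them.
\<close>
lemma is_pole_fn: "is_pole (fn n) z \<longleftrightarrow> is_pole f z"
proof
  assume "is_pole (fn n) z"
  show "is_pole f z"
  proof (rule pole_transfer[OF mero_fn[of n] mero])
    show "eventually (\<lambda>z. f z * (deriv ^^ k) f z = fn n z * (deriv ^^ k) (fn n) z) (at z)"
      using period_fn[of n z] by eventually_elim simp
  qed fact
next
  assume "is_pole f z"
  then show "is_pole (fn n) z" by (rule pole_transfer[OF mero mero_fn period_fn])
qed

lemma is_pole_shift: "is_pole f (z + of_nat n * c) \<longleftrightarrow> is_pole f z"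
proof -
  have "is_pole f (z + of_nat n * c) \<longleftrightarrow> is_pole (fn n) z"
    unfolding is_pole_def fn_def filterlim_def at_to_0[of "z + of_nat n * c"] at_to_0[of z]
    by (simp add: filtermap_filtermap algebra_simps)
  then show ?thesis by (simp add: is_pole_fn)
qed

lemma analytic_at: "\<not> is_pole f z \<Longrightarrow> f analytic_on {z}"
  using nice nicely_meromorphic_on_imp_analytic_at by blast

lemma analytic_fn: "\<not> is_pole f z \<Longrightarrow> fn n analytic_on {z}"
proof -
  assume "\<not> is_pole f z"
  then have "f analytic_on {z + of_nat n * c}" using analytic_at is_pole_shift by blast
  then show ?thesis unfolding fn_def
    by (intro analytic_on_compose_gen[of "\<lambda>z. z + of_nat n * c" "{z}" f "{z + of_nat n * c}", unfolded o_def])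
       (auto intro: analytic_intros)
qed

text \<open>
  The normal form of \<open>f\<close> makes both sides continuous away from the poles, so the almost
  everywhere identity holds at every such point.
\<close>
lemma H_fn:
  assumes "\<not> is_pole f z"
  shows "fn n z * (deriv ^^ k) (fn n) z = H z"
proof -
  have "(\<lambda>z. fn n z * (deriv ^^ k) (fn n) z) analytic_on {z}" "H analytic_on {z}"
    unfolding H_def using analytic_fn[OF assms, of n] analytic_at[OF assms]
    by (auto intro!: analytic_intros)
  then have "(\<lambda>z. fn n z * (deriv ^^ k) (fn n) z) \<midarrow>z\<rightarrow> fn n z * (deriv ^^ k) (fn n) z" "H \<midarrow>z\<rightarrow> H z"
    using analytic_at_imp_isCont isContD by blast+
  moreover have "eventually (\<lambda>z. fn n z * (deriv ^^ k) (fn n) z = H z) (at z)"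
    using period_fn by (simp add: H_def)
  ultimately show ?thesis
    using Lim_transform_eventually LIM_unique by blast
qed

lemma alt_form_fn: "alt_form_fun k (fn n) z = alt_form_fun k f (z + of_nat n * c)"
  unfolding alt_form_fun_def fn_def by (simp add: higher_deriv_shift)

text \<open>
  The forms of \<open>fn 1\<close> and \<open>f\<close> are primitives of the same function on the connected complement of the
  poles, so they differ by a constant \<open>C\<close>. That complement is invariant under translation
  by \<open>c\<close>, hence each further translation adds \<open>C\<close> once more.
\<close>
lemma alt_form_arithmetic_progression:
  assumes "odd k"
  obtains C where "\<And>z n. \<not> is_pole f z \<Longrightarrow> alt_form_fun k (fn n) z = alt_form_fun k f z + of_nat n * C"
proof -
  define U where "U = UNIV - {z. is_pole f z}"
  have sp: "{z. is_pole f z} sparse_in UNIV"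
    using meromorphic_on_imp_not_pole_cosparse[OF mero[of UNIV]] by (simp add: eventually_cosparse)
  have U: "open U" "connected U"
    unfolding U_def using sparse_imp_connected[OF _ _ _ sp] open_diff_sparse_pts[OF _ sp] by auto
  have "((\<lambda>z. alt_form_fun k (fn 1) z - alt_form_fun k f z) has_field_derivative 0) (at z)" if "z \<in> U" for z
  proof -
    have np: "\<not> is_pole f z" using that by (simp add: U_def)
    have "((\<lambda>z. alt_form_fun k (fn 1) z - alt_form_fun k f z) has_field_derivative 
       2 * (fn 1 z * (deriv ^^ k) (fn 1) z) - 2 * (f z * (deriv ^^ k) f z)) (at z)"
      by (intro DERIV_diff DERIV_alt_form_fun analytic_fn analytic_at np assms)
    then show ?thesis using H_fn[OF np, of 1] by (simp add: H_def)
  qed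
  then have "(\<lambda>z. alt_form_fun k (fn 1) z - alt_form_fun k f z) constant_on U"
    by (rule has_field_derivative_0_imp_constant_on) (use U in auto)
  then obtain C where C: "\<And>z. z \<in> U \<Longrightarrow> alt_form_fun k (fn 1) z - alt_form_fun k f z = C"
    by (auto simp: constant_on_def)
  have "alt_form_fun k (fn n) z = alt_form_fun k f z + of_nat n * C" if np: "\<not> is_pole f z" for z n
  proof (induction n)
    case (Suc n)
    have "z + of_nat n * c \<in> U" using np is_pole_shift by (simp add: U_def)
    from C[OF this] have "alt_form_fun k f (z + of_nat n * c + c) = alt_form_fun k (fn n) z + C"
      unfolding alt_form_fn by (simp add: algebra_simps)
    then show ?case using Suc unfolding alt_form_fn by (simp add: algebra_simps)
  qed simp
  then show ?thesis using that by blast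
qed

lemma pole_free_punctured_disc:
  assumes pole: "is_pole f z0"
  obtains \<rho> where "\<rho> > 0" "\<And>z. z \<in> ball z0 \<rho> - {z0} \<Longrightarrow> \<not> is_pole f z \<and> H z \<noteq> 0"
proof -
  obtain F where F: "(\<lambda>w. f (z0 + w)) has_laurent_expansion F"
    using mero[of UNIV] by (auto simp: meromorphic_on_def)
  obtain p a where pa: "leading F (- int p) a" "a \<noteq> 0" "p > 0" using pole_leading[OF F pole] .
  have LH: "(\<lambda>w. H (z0 + w)) has_laurent_expansion F * (fls_deriv ^^ k) F"
    unfolding H_def by (intro laurent_expansion_intros laurent_higher_deriv F)
  have "falling (- int p) k \<noteq> 0" using falling_neg_sign[of "- int p" k] pa(3) by auto
  then have "F * (fls_deriv ^^ k) F \<noteq> 0"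
    using leading_mult[OF pa(1) leading_higher_deriv[OF pa(1), of k]] pa(2) by auto
  then have "eventually (\<lambda>z. H z \<noteq> 0) (at z0)"
    using has_laurent_expansion_eventually_nonzero_iff[OF LH] by blast
  moreover have "eventually (\<lambda>z. \<not> is_pole f z) (at z0)"
    using meromorphic_on_imp_not_pole_cosparse[OF mero[of UNIV]] by (simp add: eventually_cosparse_open_eq)
  ultimately have "eventually (\<lambda>z. \<not> is_pole f z \<and> H z \<noteq> 0) (at z0)"
    by eventually_elim simp
  then show ?thesis using that unfolding eventually_at by (auto simp: dist_commute)
qed

lemma fn_leading:
  assumes F: "(\<lambda>w. f (z0 + w)) has_laurent_expansion F" and pa: "leading F (- int p) a" "a \<noteq> 0" "p > 0"
  obtains G b where "(\<lambda>w. fn n (z0 + w)) has_laurent_expansion G" "leading G (- int p) b" "b = a \<or> b = - a"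
proof -
  obtain G where G: "(\<lambda>w. fn n (z0 + w)) has_laurent_expansion G"
    using mero_fn[of n z0] by (auto simp: meromorphic_on_def)
  have "leading G (- int p) a \<or> leading G (- int p) (- a)"
    by (rule pole_leading_coeff_determined[OF laurent_product_eq[OF F G period_fn] pa])
  with G that show ?thesis by blast
qed

text \<open>
  Near a pole \<open>z0\<close> all translates omit 0, because \<open>H\<close> has no zero there, and they omit \<open>\<eta>\<close>. Their leading
  coefficients have the same modulus, so each of them is bounded, by a constant independent
  of \<open>n\<close>, at some point of a fixed circle; the Schottky bound spreads this to an annulus.
\<close>
lemma fn_bounded_on_annulus:
  assumes pole: "is_pole f z0"
  obtains \<sigma> B where "\<sigma> > 0" 
    "\<And>z. \<sigma> * exp (-1) \<le> norm (z - z0) \<Longrightarrow> norm (z - z0) \<le> \<sigma> * exp 1 \<Longrightarrow> \<not> is_pole f z"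
    "\<And>n z. \<sigma> * exp (-1) \<le> norm (z - z0) \<Longrightarrow> norm (z - z0) \<le> \<sigma> * exp 1 \<Longrightarrow> norm (fn n z) \<le> B"
proof -
  obtain \<rho> where \<rho>: "\<rho> > 0" and np: "\<And>z. z \<in> ball z0 \<rho> - {z0} \<Longrightarrow> \<not> is_pole f z \<and> H z \<noteq> 0"
    using pole_free_punctured_disc[OF pole] by blast
  define \<sigma> where "\<sigma> = \<rho> * exp (-10)"
  have \<sigma>: "\<sigma> > 0" "\<sigma> * exp 10 \<le> \<rho>" using \<rho> by (simp_all add: \<sigma>_def exp_minus)
  have "\<sigma> < \<sigma> * exp 10" using \<sigma> by simp
  with \<sigma> have \<sigma>\<rho>: "\<sigma> < \<rho>" by linarith
  obtain F where F: "(\<lambda>w. f (z0 + w)) has_laurent_expansion F"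
    using mero[of UNIV] by (auto simp: meromorphic_on_def)
  obtain p a where pa: "leading F (- int p) a" "a \<noteq> 0" "p > 0" using pole_leading[OF F pole] .
  have hol: "fn n holomorphic_on ball z0 \<rho> - {z0}" for n
    by (rule analytic_imp_holomorphic, subst analytic_on_analytic_at) (use analytic_fn np in blast)
  have nz: "fn n z \<noteq> 0" if "z \<in> ball z0 \<rho> - {z0}" for n z
    using H_fn[of z n] np[OF that] by auto
  have n\<eta>: "fn n z \<noteq> \<eta>" if "z \<in> ball z0 \<rho> - {z0}" for n z
    using omit[of "z + of_nat n * c"] np[OF that] is_pole_shift[of z n] unfolding fn_def by blast
  have small: "\<exists>w. norm (w - z0) = \<sigma> \<and> norm (fn n w) \<le> norm a / \<sigma> ^ p" for n
  proof -
    obtain G b where G: "(\<lambda>w. fn n (z0 + w)) has_laurent_expansion G" "leading G (- int p) b" "b = a \<or> b = - a"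
      using fn_leading[OF F pa] .
    then have b: "b \<noteq> 0" "norm b = norm a" using pa by auto
    show ?thesis
      using pole_small_value_on_circle[OF hol[of n] nz[of _ n] G(1,2) b(1) \<sigma>(1) \<sigma>\<rho>] b(2) by auto
  qed
  define R where "R = norm a / \<sigma> ^ p / norm \<eta>"
  show ?thesis
  proof
    show "\<sigma> > 0" by fact
    fix z assume z: "\<sigma> * exp (-1) \<le> norm (z - z0)" "norm (z - z0) \<le> \<sigma> * exp 1"
    have "\<sigma> * exp 1 < \<sigma> * exp 10" using \<sigma> by simp
    with z \<sigma> have "norm (z - z0) < \<rho>" by linarith
    moreover have "0 < \<sigma> * exp (-1)" using \<sigma> by simp
    with z have "norm (z - z0) > 0" by linarith
    ultimately have "z \<in> ball z0 \<rho> - {z0}" by (auto simp: dist_norm norm_minus_commute)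
    with np show "\<not> is_pole f z" by blast
    fix n
    obtain w where w: "norm (w - z0) = \<sigma>" "norm (fn n w) \<le> norm a / \<sigma> ^ p" using small by blast
    have "norm (fn n z / \<eta>) \<le> exp (pi * exp (pi * (17 + 2 * R)))"
    proof (rule punctured_disc_Schottky[OF _ _ \<sigma> w(1) _ z])
      show "(\<lambda>z. fn n z / \<eta>) holomorphic_on ball z0 \<rho> - {z0}"
        by (intro holomorphic_intros hol) (use \<eta> in auto)
      show "norm (fn n w / \<eta>) \<le> R"
        unfolding R_def norm_divide by (intro divide_right_mono w(2)) auto
      show "fn n z / \<eta> \<noteq> 0 \<and> fn n z / \<eta> \<noteq> 1" if "z \<in> ball z0 \<rho> - {z0}" for z
        using nz[OF that, of n] n\<eta>[OF that, of n] \<eta> by auto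
    qed
    then show "norm (fn n z) \<le> exp (pi * exp (pi * (17 + 2 * R))) * norm \<eta>"
      using \<eta> by (simp add: norm_divide field_simps)
  qed
qed

text \<open>
  By Cauchy's estimates the uniform bound on the annulus also bounds the forms of all the \<open>fn n\<close> at a point
  of the circle. They run through an arithmetic progression, so its difference is 0.
\<close>
lemma alt_form_fn_eq:
  assumes pole: "is_pole f z0" and k_odd: "odd k" and np: "\<not> is_pole f z"
  shows "alt_form_fun k (fn n) z = alt_form_fun k f z"
proof -
  obtain C where C: "\<And>z n. \<not> is_pole f z \<Longrightarrow> alt_form_fun k (fn n) z = alt_form_fun k f z + of_nat n * C"
    using alt_form_arithmetic_progression[OF k_odd] by blast
  obtain \<sigma> B where \<sigma>: "\<sigma> > 0" 
    and ann: "\<And>z. \<sigma> * exp (-1) \<le> norm (z - z0) \<Longrightarrow> norm (z - z0) \<le> \<sigma> * exp 1 \<Longrightarrow> \<not> is_pole f z"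
    and B: "\<And>n z. \<sigma> * exp (-1) \<le> norm (z - z0) \<Longrightarrow> norm (z - z0) \<le> \<sigma> * exp 1 \<Longrightarrow> norm (fn n z) \<le> B"
    using fn_bounded_on_annulus[OF pole] by metis
  define w where "w = z0 + of_real \<sigma>"
  have near: "\<sigma> * exp (-1) \<le> norm (z - z0) \<and> norm (z - z0) \<le> \<sigma> * exp 1" if "norm (w - z) \<le> \<sigma> / 2" for z
  proof -
    have "norm (w - z0) = \<sigma>" using \<sigma> by (simp add: w_def)
    moreover have "norm (w - z0) \<le> norm (w - z) + norm (z - z0)" "norm (z - z0) \<le> norm (w - z) + norm (w - z0)"
      using norm_triangle_ineq[of "w - z" "z - z0"] norm_triangle_ineq4[of "w - z0" "w - z"] by auto
    moreover have "exp (-1) \<le> (1/2 :: real)" "exp 1 \<ge> (2 :: real)"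
      using exp_ge_add_one_self[of "1::real"] by (simp_all add: exp_minus field_simps)
    then have "\<sigma> * exp (-1) \<le> \<sigma> * (1/2)" "\<sigma> * 2 \<le> \<sigma> * exp 1" using \<sigma> by auto
    ultimately show ?thesis using that by auto
  qed
  define M where "M = (\<Sum>j<k. (fact j * B / (\<sigma>/2) ^ j) * (fact (k - 1 - j) * B / (\<sigma>/2) ^ (k - 1 - j)))"
  have bound: "norm (alt_form_fun k (fn n) w) \<le> M" for n
  proof -
    have an: "fn n analytic_on cball w (\<sigma>/2)"
    proof (subst analytic_on_analytic_at, intro ballI)
      fix z assume "z \<in> cball w (\<sigma>/2)"
      then have "norm (w - z) \<le> \<sigma> / 2" by (simp add: dist_norm)
      from near[OF this] have "\<not> is_pole f z" using ann by blast
      then show "fn n analytic_on {z}" by (rule analytic_fn)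
    qed
    have d: "norm ((deriv ^^ j) (fn n) w) \<le> fact j * B / (\<sigma>/2) ^ j" for j
    proof (rule Cauchy_inequality)
      show "fn n holomorphic_on ball w (\<sigma>/2)" 
        using an analytic_imp_holomorphic ball_subset_cball holomorphic_on_subset by blast
      show "continuous_on (cball w (\<sigma>/2)) (fn n)"
        using an analytic_imp_holomorphic holomorphic_on_imp_continuous_on by blast
      show "norm (fn n x) \<le> B" if "norm (w - x) = \<sigma>/2" for x
        using near[of x] that B by auto
    qed (use \<sigma> in auto)
    show ?thesis unfolding alt_form_fun_def M_def
    proof (rule sum_norm_le)
      fix j
      have "norm ((deriv ^^ j) (fn n) w * (deriv ^^ (k - 1 - j)) (fn n) w) \<le> 
        (fact j * B / (\<sigma>/2) ^ j) * (fact (k - 1 - j) * B / (\<sigma>/2) ^ (k - 1 - j))"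
        unfolding norm_mult by (rule mult_mono'[OF d d]) auto
      then show "norm ((-1) ^ j * ((deriv ^^ j) (fn n) w * (deriv ^^ (k - 1 - j)) (fn n) w)) \<le> 
        (fact j * B / (\<sigma>/2) ^ j) * (fact (k - 1 - j) * B / (\<sigma>/2) ^ (k - 1 - j))"
        by (simp add: norm_mult norm_power)
    qed
  qed
  have "C = 0"
  proof (rule ccontr)
    assume "C \<noteq> 0"
    have npw: "\<not> is_pole f w" using near[of w] ann[of w] \<sigma> by auto
    obtain n :: nat where n: "real n * norm C > 2 * M"
      using \<open>C \<noteq> 0\<close> reals_Archimedean3[of "norm C"] by auto
    have "norm (of_nat n * C) = norm (alt_form_fun k (fn n) w - alt_form_fun k (fn 0) w)"
      using C[OF npw, of n] by simp
    also have "\<dots> \<le> M + M" using bound[of n] bound[of 0] norm_triangle_ineq4 by (smt (verit))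
    finally show False using n by (simp add: norm_mult)
  qed
  then show ?thesis using C[OF np, of n] by simp
qed

text \<open>
  There are only two candidates for the leading coefficient at the pole, so two of the three functions
  \<open>fn 0\<close>, \<open>fn 1\<close>, \<open>fn 2\<close> share it, and these two are equal by rigidity.
\<close>
lemma periodic_if_pole:
  assumes pole: "is_pole f z0"
  shows "periodic_meromorphic f"
proof -
  obtain F where F: "(\<lambda>w. f (z0 + w)) has_laurent_expansion F"
    using mero[of UNIV] by (auto simp: meromorphic_on_def)
  obtain p a where pa: "leading F (- int p) a" "a \<noteq> 0" "p > 0" using pole_leading[OF F pole] .
  have "\<exists>G b. (\<lambda>w. fn n (z0 + w)) has_laurent_expansion G \<and> leading G (- int p) b \<and> (b = a \<or> b = - a)" for n
    using fn_leading[OF F pa] by metis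
  then obtain G b where G: "\<And>n. (\<lambda>w. fn n (z0 + w)) has_laurent_expansion G n"
    and b: "\<And>n. leading (G n) (- int p) (b n)" "\<And>n. b n = a \<or> b n = - a"
    by metis
  have "b 0 = b 1 \<or> b 0 = b 2 \<or> b 1 = b 2" using b(2) by metis
  then obtain i j :: nat where ij: "i < j" "b i = b j"
    by (metis one_less_numeral_iff semiring_norm(76) zero_less_numeral zero_less_one)
  have alt: "alt_form k (G i) (G i) = alt_form k (G j) (G j)" if "odd k"
  proof (rule has_laurent_expansion_unique)
    show "(\<lambda>w. alt_form_fun k (fn i) (z0 + w)) has_laurent_expansion alt_form k (G i) (G i)"
      by (rule laurent_alt_form[OF G])
    have "(\<lambda>w. alt_form_fun k (fn j) (z0 + w)) has_laurent_expansion alt_form k (G j) (G j)"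
      by (rule laurent_alt_form[OF G])
    moreover have "eventually (\<lambda>z. \<not> is_pole f z) (at z0)"
      using meromorphic_on_imp_not_pole_cosparse[OF mero[of UNIV]] by (simp add: eventually_cosparse_open_eq)
    then have "eventually (\<lambda>z. alt_form_fun k (fn j) z = alt_form_fun k (fn i) z) (at z0)"
      by eventually_elim (simp add: alt_form_fn_eq[OF pole that])
    then have ev': "eventually (\<lambda>w. alt_form_fun k (fn j) (z0 + w) = alt_form_fun k (fn i) (z0 + w)) (at 0)"
      by (subst (asm) eventually_at_to_0) (simp add: add.commute)
    ultimately show "(\<lambda>w. alt_form_fun k (fn i) (z0 + w)) has_laurent_expansion alt_form k (G j) (G j)"
      using has_laurent_expansion_cong[OF ev' refl] by simp
  qed
  have bi: "b i \<noteq> 0" using b(2)[of i] pa(2) by auto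
  have ev: "eventually (\<lambda>z. fn j z * (deriv ^^ k) (fn j) z = fn i z * (deriv ^^ k) (fn i) z) (at z0)"
    using period_fn[of i z0] period_fn[of j z0] by eventually_elim simp
  have "G i = G j"
    by (rule pole_rigidity[OF laurent_product_eq[OF G G ev] alt b(1) bi pa(3) _ k]) (use ij b(1)[of j] in auto)
  define d where "d z = fn j z - fn i z" for z
  have "(\<lambda>w. d (z0 + w)) has_laurent_expansion G j - G i"
    unfolding d_def by (intro laurent_expansion_intros G)
  then have "eventually (\<lambda>z. d z = 0) (at z0)"
    using has_laurent_expansion_eventually_zero_iff \<open>G i = G j\<close> by force
  then have nev: "\<not> eventually (\<lambda>z. d z \<noteq> 0) (at z0)"
    using eventually_elim2[where F = "at z0" and R = "\<lambda>_. False"] by fastforce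
  have "d meromorphic_on UNIV"
    unfolding d_def using mero_fn meromorphic_on_meromorphic_at by (intro meromorphic_intros) blast+
  then have "(\<forall>\<^sub>\<approx>z. d z = 0) \<or> (\<forall>\<^sub>\<approx>z. d z \<noteq> 0)"
    by (rule meromorphic_imp_constant_or_avoid) auto
  with nev have "\<forall>\<^sub>\<approx>z. d z = 0" by (auto simp: eventually_cosparse_open_eq)
  then have "eventually (\<lambda>w. d w = 0) (at (z - of_nat i * c))" for z
    by (simp add: eventually_cosparse_open_eq)
  then have "eventually (\<lambda>w. d (w - of_nat i * c) = 0) (at z)" for z
    using eventually_at_shift[of "\<lambda>w. d (w - of_nat i * c) = 0" "z - of_nat i * c" "of_nat i * c"] by simp
  moreover have "d (w - of_nat i * c) = f (w + of_nat (j - i) * c) - f w" for w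
    using ij by (simp add: d_def fn_def of_nat_diff algebra_simps)
  ultimately have "\<forall>\<^sub>\<approx>w. f (w + of_nat (j - i) * c) = f w"
    by (simp add: eventually_cosparse_open_eq)
  then show ?thesis
    unfolding periodic_meromorphic_def using ij c by (intro exI[of _ "of_nat (j - i) * c"]) auto
qed

end

section \<open>Means over circles\<close>

definition unit_cis :: "real \<Rightarrow> complex" where
  "unit_cis t = exp (2 * of_real pi * \<i> * of_real t)"

lemma norm_unit_cis [simp]: "norm (unit_cis t) = 1"
  by (simp add: unit_cis_def norm_exp_eq_Re)

lemma unit_cis_nonzero [simp]: "unit_cis t \<noteq> 0"
  by (simp add: unit_cis_def)

lemma unit_cis_add: "unit_cis (s + t) = unit_cis s * unit_cis t"
  by (simp add: unit_cis_def exp_add[symmetric] algebra_simps)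

lemma continuous_on_unit_cis [continuous_intros]:
  "continuous_on A f \<Longrightarrow> continuous_on A (\<lambda>x. unit_cis (f x))"
  unfolding unit_cis_def by (intro continuous_intros)

lemma unit_cis_surj:
  assumes "norm z = R" "R > 0"
  obtains t where "z = of_real R * unit_cis t"
proof -
  have "z = of_real R * exp (\<i> * of_real (Arg z))"
    using assms Arg_eq[of z] by auto
  also have "exp (\<i> * of_real (Arg z)) = unit_cis (Arg z / (2 * pi))"
    by (simp add: unit_cis_def mult_ac)
  finally show ?thesis using that by blast
qed

lemma dist_unit_cis: "norm (unit_cis s - unit_cis t) \<le> 2 * pi * \<bar>s - t\<bar>"
proof -
  have "unit_cis s - unit_cis t = unit_cis t * (exp (\<i> * of_real (2 * pi * (s - t))) - 1)"
    by (simp add: unit_cis_def exp_add[symmetric] algebra_simps)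
  then have "norm (unit_cis s - unit_cis t) = 2 * \<bar>sin (2 * pi * (s - t) / 2)\<bar>"
    by (simp only: norm_mult norm_unit_cis dist_exp_i_1 mult_1)
  also have "\<dots> \<le> 2 * \<bar>2 * pi * (s - t) / 2\<bar>"
    by (intro mult_left_mono abs_sin_x_le_abs_x) auto
  also have "\<dots> = 2 * pi * \<bar>s - t\<bar>" by (simp add: abs_mult)
  finally show ?thesis .
qed

lemma circle_mean_value:
  assumes hol: "f holomorphic_on cball 0 R" and z: "norm z < R"
  shows "((\<lambda>t. f (of_real R * unit_cis t) * (of_real R * unit_cis t) / (of_real R * unit_cis t - z)) 
     has_integral f z) {0..1}"
proof -
  have R: "R > 0" using z by (rule le_less_trans[OF norm_ge_zero])
  have cp: "circlepath 0 R t = of_real R * unit_cis t" "exp (2 * of_real pi * \<i> * of_real t) = unit_cis t" for t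
    by (simp_all add: circlepath unit_cis_def)
  have "((\<lambda>u. f u / (u - z)) has_contour_integral (2 * of_real pi * \<i> * f z)) (circlepath 0 R)"
    by (rule Cauchy_integral_circlepath_simple[OF hol]) (use z in simp)
  then have "((\<lambda>t. f (of_real R * unit_cis t) / (of_real R * unit_cis t - z) * 
      (2 * of_real pi * \<i> * (of_real R * unit_cis t))) has_integral (2 * of_real pi * \<i> * f z)) {0..1}"
    unfolding has_contour_integral_def
    by (rule has_integral_eq[rotated]) (simp add: vector_derivative_circlepath01 cp(1) unit_cis_def mult_ac)
  then have "((\<lambda>t. f (of_real R * unit_cis t) / (of_real R * unit_cis t - z) * 
      (2 * of_real pi * \<i> * (of_real R * unit_cis t)) * inverse (2 * of_real pi * \<i>)) has_integral 
      (2 * of_real pi * \<i> * f z) * inverse (2 * of_real pi * \<i>)) {0..1}"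
    by (rule has_integral_mult_left)
  then show ?thesis by (simp add: field_simps)
qed

text \<open>
  Cauchy's formula expresses \<open>f z\<close> by the values \<open>f u\<close> on the circle with the kernel \<open>u / (u - z)\<close>. With
  the conjugate values, the same kernel yields \<open>cnj (f 0)\<close>: conjugation turns it into a kernel that is
  holomorphic in the disc. Adding both leaves the real part under the integral.
\<close>
lemma Schwarz_formula:
  assumes hol: "f holomorphic_on cball 0 R" and z: "norm z < R"
  shows "((\<lambda>t. 2 * of_real (Re (f (of_real R * unit_cis t))) * 
        ((of_real R * unit_cis t) / (of_real R * unit_cis t - z))) has_integral (f z + cnj (f 0))) {0..1}"
proof -
  have R: "R > 0" using z by (rule le_less_trans[OF norm_ge_zero])
  \<comment> \<open>on the circle, the factor next to \<open>f u\<close> is the conjugate of \<open>u / (u - z)\<close>\<close>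
  define h where "h u = f u * (of_real R ^ 2 / (of_real R ^ 2 - cnj z * u))" for u
  have nz: "of_real R ^ 2 - cnj z * u \<noteq> 0" if "u \<in> cball 0 R" for u
  proof
    assume "of_real R ^ 2 - cnj z * u = 0"
    then have "norm (cnj z * u) = norm ((of_real R)^2 :: complex)" by simp
    then have "norm z * norm u = R ^ 2" using R by (simp add: norm_mult norm_power)
    moreover have "norm z * norm u \<le> norm z * R" using that by (intro mult_left_mono) auto
    moreover have "norm z * R < R * R" using z R by simp
    ultimately show False by (simp add: power2_eq_square)
  qed
  have "h holomorphic_on cball 0 R"
    unfolding h_def by (intro holomorphic_intros hol) (use nz in auto)
  from circle_mean_value[OF this, of 0] R
  have "((\<lambda>t. h (of_real R * unit_cis t)) has_integral h 0) {0..1}" by simp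
  then have "((\<lambda>t. cnj (h (of_real R * unit_cis t))) has_integral cnj (h 0)) {0..1}"
    using has_integral_linear[OF _ bounded_linear_cnj] by (auto simp: o_def)
  moreover have "h 0 = f 0" using R by (simp add: h_def)
  moreover have "cnj (h (of_real R * unit_cis t)) = 
      cnj (f (of_real R * unit_cis t)) * ((of_real R * unit_cis t) / (of_real R * unit_cis t - z))" for t
  proof -
    define u where "u = of_real R * unit_cis t"
    have u: "u \<in> cball 0 R" "u \<noteq> 0" using R by (auto simp: u_def norm_mult)
    have "u - z \<noteq> 0" using z R by (auto simp: u_def norm_mult)
    have uu: "(of_real R ^ 2 :: complex) = u * cnj u"
    proof -
      have "norm u = R" using R by (simp add: u_def norm_mult)
      then show ?thesis using complex_norm_square[of u] by simp
    qed
    have "cnj (of_real R ^ 2 / (of_real R ^ 2 - cnj z * u)) = (u * cnj u) / (u * cnj u - z * cnj u)"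
      unfolding uu by (simp add: mult.commute)
    also have "\<dots> = u / (u - z)"
      using u by (simp add: left_diff_distrib[symmetric])
    finally have "cnj (h u) = cnj (f u) * (u / (u - z))"
      unfolding h_def complex_cnj_mult by (rule arg_cong)
    then show ?thesis unfolding u_def .
  qed
  ultimately have "((\<lambda>t. cnj (f (of_real R * unit_cis t)) * ((of_real R * unit_cis t) / (of_real R * unit_cis t - z)))
       has_integral cnj (f 0)) {0..1}" by simp
  from has_integral_add[OF circle_mean_value[OF hol z] this]
  moreover have "f u * u / (u - z) + cnj (f u) * (u / (u - z)) = 2 * of_real (Re (f u)) * (u / (u - z))" for u
  proof -
    have "2 * of_real (Re (f u)) = f u + cnj (f u)" by (simp add: complex_add_cnj)
    then show ?thesis by (simp add: add_divide_distrib distrib_right)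
  qed
  ultimately show ?thesis by (simp only:)
qed

text \<open>
  Bounding by the mean of the positive part of \<open>Re f\<close>, instead of its maximum, is what makes the
  estimate comparable with \<open>Jensen_bound\<close>: this mean is the Nevanlinna proximity function of \<open>exp \<circ> f\<close>.
\<close>
lemma Borel_Caratheodory_mean:
  assumes hol: "f holomorphic_on cball 0 R" and z: "norm z < R"
  shows "norm (f z) \<le> norm (f 0) + 2 * (R / (R - norm z)) *
     (2 * integral {0..1} (\<lambda>t. max 0 (Re (f (of_real R * unit_cis t)))) + norm (f 0))"
proof -
  have R: "R > 0" using z by (rule le_less_trans[OF norm_ge_zero])
  have cont: "continuous_on {0..1} (\<lambda>t. f (of_real R * unit_cis t))"
    by (rule continuous_on_compose2[OF holomorphic_on_imp_continuous_on[OF hol]])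
       (use R in \<open>auto intro!: continuous_intros simp: norm_mult\<close>)
  define u where "u t = Re (f (of_real R * unit_cis t))" for t
  have cu: "continuous_on {0..1} u" unfolding u_def by (intro continuous_intros cont)
  have "norm (f z + cnj (f 0)) \<le> integral {0..1} (\<lambda>t. 2 * (R / (R - norm z)) * \<bar>u t\<bar>)"
  proof (rule integral_norm_bound_integral[THEN order_trans[rotated], OF has_integral_integrable[OF Schwarz_formula[OF hol z]]])
    show "norm (f z + cnj (f 0)) \<le> norm (integral {0..1} (\<lambda>t. 2 * of_real (Re (f (of_real R * unit_cis t))) * 
        ((of_real R * unit_cis t) / (of_real R * unit_cis t - z))))"
      using integral_unique[OF Schwarz_formula[OF hol z]] by simp
    show "(\<lambda>t. 2 * (R / (R - norm z)) * \<bar>u t\<bar>) integrable_on {0..1}"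
      by (intro integrable_continuous_interval continuous_intros cu)
    fix t :: real
    have "norm (of_real R * unit_cis t - z) \<ge> R - norm z"
      using norm_triangle_ineq2[of "of_real R * unit_cis t" z] R by (simp add: norm_mult)
    then have "R / norm (of_real R * unit_cis t - z) \<le> R / (R - norm z)"
      using z R by (intro divide_left_mono mult_pos_pos) auto
    then have "2 * \<bar>u t\<bar> * (R / norm (of_real R * unit_cis t - z)) \<le> 2 * \<bar>u t\<bar> * (R / (R - norm z))"
      by (intro mult_left_mono) auto
    then show "norm (2 * of_real (Re (f (of_real R * unit_cis t))) * 
        ((of_real R * unit_cis t) / (of_real R * unit_cis t - z))) \<le> 2 * (R / (R - norm z)) * \<bar>u t\<bar>"
      using R by (simp add: norm_mult norm_divide u_def mult_ac)
  qed
  also have "\<dots> = 2 * (R / (R - norm z)) * integral {0..1} (\<lambda>t. \<bar>u t\<bar>)"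
    by simp
  also have "integral {0..1} (\<lambda>t. \<bar>u t\<bar>) = integral {0..1} (\<lambda>t. 2 * max 0 (u t) - u t)"
    by (intro integral_cong) auto
  also have "\<dots> = 2 * integral {0..1} (\<lambda>t. max 0 (u t)) - integral {0..1} u"
    by (subst integral_diff) (auto intro!: integrable_continuous_interval continuous_intros cu)
  also have "integral {0..1} u = Re (f 0)"
  proof -
    have "((\<lambda>t. f (of_real R * unit_cis t)) has_integral f 0) {0..1}"
      using circle_mean_value[OF hol, of 0] R by simp
    then have "((\<lambda>t. Re (f (of_real R * unit_cis t))) has_integral Re (f 0)) {0..1}"
      using has_integral_linear[OF _ bounded_linear_Re] by (auto simp: o_def)
    then show ?thesis by (simp add: u_def[abs_def] integral_unique)
  qed
  finally have "norm (f z + cnj (f 0)) \<le> 2 * (R / (R - norm z)) * (2 * integral {0..1} (\<lambda>t. max 0 (u t)) - Re (f 0))" .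
  also have "\<dots> \<le> 2 * (R / (R - norm z)) * (2 * integral {0..1} (\<lambda>t. max 0 (u t)) + norm (f 0))"
    using z R abs_Re_le_cmod[of "f 0"] by (intro mult_left_mono) auto
  finally have "norm (f z + cnj (f 0)) \<le> 2 * (R / (R - norm z)) * (2 * integral {0..1} (\<lambda>t. max 0 (u t)) + norm (f 0))" .
  moreover have "norm (f z) \<le> norm (f z + cnj (f 0)) + norm (f 0)"
    using norm_triangle_ineq4[of "f z + cnj (f 0)" "cnj (f 0)"] by simp
  ultimately show ?thesis unfolding u_def by linarith
qed

text \<open>
  Jensen's inequality \<open>ln \<bar>h 0\<bar> \<le> ln A - mean \<psi>\<close>, up to an additive constant 1. To avoid the singularities of \<open>ln \<bar>h\<bar>\<close>, apply the maximum principle to the product of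
  \<open>h\<close> over the rotations by the \<open>N\<close>-th roots of unity: at 0 it equals \<open>(h 0)\<^sup>N\<close>, and on the
  circle its logarithm is controlled by Riemann sums of \<open>\<psi>\<close>. The sums start at an arbitrary point of the circle,
  hence the means over all rotated parametrisations in the last assumption.
\<close>
lemma Jensen_bound:
  fixes h :: "complex \<Rightarrow> complex" and \<psi> :: "complex \<Rightarrow> real"
  assumes hol: "h holomorphic_on cball 0 R" and R: "R > 0" and A: "A > 0"
    and cont: "continuous_on (sphere 0 R) \<psi>"
    and bound: "\<And>z. norm z = R \<Longrightarrow> norm (h z) \<le> A * exp (- \<psi> z)"
    and mean: "\<And>s. m \<le> integral {0..1} (\<lambda>t. \<psi> (of_real R * unit_cis (s + t)))"
  shows "norm (h 0) \<le> A * exp (1 - m)"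
proof -
  have "uniformly_continuous_on (sphere 0 R) \<psi>"
    using cont by (rule compact_uniformly_continuous) auto
  then obtain \<delta> where \<delta>: "\<delta> > 0" 
    "\<And>x y. x \<in> sphere 0 R \<Longrightarrow> y \<in> sphere 0 R \<Longrightarrow> dist y x < \<delta> \<Longrightarrow> dist (\<psi> y) (\<psi> x) < 1"
    unfolding uniformly_continuous_on_def by (meson zero_less_one)
  obtain N :: nat where N: "N > 0" "2 * pi * R / real N < \<delta>"
  proof -
    obtain n :: nat where "2 * pi * R < real n * \<delta>"
      using reals_Archimedean3[OF \<delta>(1)] by blast
    moreover from this have "n > 0" using R by (cases n) (auto simp: mult_less_0_iff)
    ultimately show ?thesis using that[of n] by (simp add: field_simps)
  qed
  have sph: "of_real R * unit_cis t \<in> sphere 0 R" for t using R by (simp add: norm_mult)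
  have sum_ge: "real N * (m - 1) \<le> (\<Sum>j<N. \<psi> (of_real R * unit_cis (s + real j / real N)))" for s
  proof -
    define q where "q t = \<psi> (of_real R * unit_cis (s + t))" for t
    have cq: "continuous_on A q" for A
      unfolding q_def by (rule continuous_on_compose2[OF cont]) (use sph in \<open>auto intro!: continuous_intros\<close>)
    have int: "q integrable_on {a..b}" for a b by (rule integrable_continuous_interval[OF cq])
    have piece: "integral {real j / N..real (Suc j) / N} q \<le> (q (real j / N) + 1) / N" for j
    proof -
      have "integral {real j / N..real (Suc j) / N} q \<le> integral {real j / N..real (Suc j) / N} (\<lambda>_. q (real j / N) + 1)"
      proof (rule integral_le[OF int])
        fix t assume t: "t \<in> {real j / N..real (Suc j) / N}"
        then have "\<bar>t - real j / N\<bar> \<le> 1 / N" by (auto simp: add_divide_distrib abs_le_iff)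
        have "dist (of_real R * unit_cis (s + t)) (of_real R * unit_cis (s + real j / N)) = 
            R * norm (unit_cis (s + t) - unit_cis (s + real j / N))"
          using R by (simp add: dist_norm right_diff_distrib[symmetric] norm_mult)
        also have "\<dots> \<le> R * (2 * pi * \<bar>(s + t) - (s + real j / N)\<bar>)"
          using R by (intro mult_left_mono dist_unit_cis) auto
        also have "\<dots> = (2 * pi * R) * \<bar>t - real j / N\<bar>" by simp
        also have "\<dots> \<le> (2 * pi * R) * (1 / N)"
          using R \<open>\<bar>t - real j / N\<bar> \<le> 1 / N\<close> by (intro mult_left_mono) auto
        also have "\<dots> < \<delta>" using N by simp
        finally have "dist (q t) (q (real j / N)) < 1" unfolding q_def by (intro \<delta>(2) sph)
        then show "q t \<le> q (real j / N) + 1" by (simp add: dist_real_def)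
      qed auto
      also have "\<dots> = (q (real j / N) + 1) / N" using N by (simp add: field_simps)
      finally show ?thesis .
    qed
    have "integral {0..real n / N} q \<le> (\<Sum>j<n. (q (real j / N) + 1) / N)" for n
    proof (induction n)
      case (Suc n)
      have "integral {0..real n / N} q + integral {real n / N..real (Suc n) / N} q = integral {0..real (Suc n) / N} q"
        by (rule Henstock_Kurzweil_Integration.integral_combine[OF _ _ int]) (use N in \<open>auto simp: field_simps\<close>)
      then show ?case using Suc piece[of n] by simp
    qed simp
    from this[of N] N have "integral {0..1} q \<le> (\<Sum>j<N. (q (real j / N) + 1) / N)" by simp
    also have "\<dots> = ((\<Sum>j<N. q (real j / N)) + N) / N" 
      by (simp add: sum_divide_distrib[symmetric] sum.distrib)
    finally have "integral {0..1} q \<le> ((\<Sum>j<N. q (real j / N)) + N) / N" .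
    moreover have "m \<le> integral {0..1} q" using mean[of s] by (simp add: q_def[abs_def])
    ultimately have "m \<le> ((\<Sum>j<N. q (real j / N)) + N) / N" by linarith
    then show ?thesis using N by (simp add: q_def field_simps)
  qed
  define P where "P z = (\<Prod>j<N. h (z * unit_cis (real j / N)))" for z
  have "norm (P 0) \<le> A ^ N * exp (- (real N * (m - 1)))"
  proof (rule maximum_modulus_frontier[where f = P and \<xi> = 0 and S = "cball 0 R"])
    have "P holomorphic_on cball 0 R"
      unfolding P_def
    proof (intro holomorphic_on_prod)
      fix j
      show "(\<lambda>z. h (z * unit_cis (real j / N))) holomorphic_on cball 0 R"
        by (rule holomorphic_on_compose_gen[OF _ hol, unfolded o_def])
           (auto intro!: holomorphic_intros simp: norm_mult)
    qed
    then show "P holomorphic_on interior (cball 0 R)" "continuous_on (closure (cball 0 R)) P"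
      using holomorphic_on_subset interior_subset by (blast, simp add: holomorphic_on_imp_continuous_on)
    fix z :: complex assume "z \<in> frontier (cball 0 R)"
    then have z: "norm z = R" using R by simp
    obtain s where s: "z = of_real R * unit_cis s" using unit_cis_surj[OF z R] .
    have "norm (P z) = (\<Prod>j<N. norm (h (z * unit_cis (real j / N))))"
      by (simp add: P_def prod_norm)
    also have "\<dots> \<le> (\<Prod>j<N. A * exp (- \<psi> (z * unit_cis (real j / N))))"
      by (intro prod_mono conjI bound norm_ge_zero) (use z in \<open>simp add: norm_mult\<close>)
    also have "\<dots> = A ^ N * exp (- (\<Sum>j<N. \<psi> (of_real R * unit_cis (s + real j / N))))"
      by (simp add: prod.distrib exp_sum[symmetric] sum_negf s unit_cis_add mult_ac)
    also have "\<dots> \<le> A ^ N * exp (- (real N * (m - 1)))"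
      using sum_ge[of s] A by (intro mult_left_mono) auto
    finally show "norm (P z) \<le> A ^ N * exp (- (real N * (m - 1)))" .
  qed (use R in auto)
  also have "\<dots> = (A * exp (1 - m)) ^ N"
    by (simp add: power_mult_distrib exp_of_nat_mult[symmetric] algebra_simps)
  also have "norm (P 0) = norm (h 0) ^ N"
    by (simp add: P_def norm_power)
  finally show ?thesis
    using N A by (subst (asm) power_mono_iff) auto
qed

section \<open>Small functions with respect to a growth scale\<close>

text \<open>
  If every step \<open>r \<mapsto> r (1 + 1 / L r)\<close> more than doubled \<open>L\<close>, then \<open>L\<close> would grow like \<open>2\<^sup>n\<close> along the iterates,
  while the iterates stay below \<open>r0 exp 2\<close> because the values of \<open>1 / L\<close> add up to at most 2.
\<close>
lemma Borel_growth_lemma: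
  fixes L :: "real \<Rightarrow> real"
  assumes mono: "\<And>x y. 0 \<le> x \<Longrightarrow> x \<le> y \<Longrightarrow> L x \<le> L y" and ge1: "\<And>x. 0 \<le> x \<Longrightarrow> L x \<ge> 1"
    and r0: "r0 > 0"
  obtains r where "r \<ge> r0" "L (r * (1 + 1 / L r)) \<le> 2 * L r"
proof (rule ccontr)
  assume "\<not> thesis"
  with that have neg: "2 * L r < L (r * (1 + 1 / L r))" if "r \<ge> r0" for r
    using that by (meson not_le)
  define s where "s = rec_nat r0 (\<lambda>_ r. r * (1 + 1 / L r))"
  have s_0: "s 0 = r0" and s_Suc: "s (Suc n) = s n * (1 + 1 / L (s n))" for n
    by (simp_all add: s_def)
  have s_ge: "s n \<ge> r0" for n
  proof (induction n)
    case (Suc n)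
    then have "s n * 1 \<le> s n * (1 + 1 / L (s n))"
      using ge1[of "s n"] r0 by (intro mult_left_mono) auto
    then show ?case using Suc by (simp add: s_Suc)
  qed (simp add: s_0)
  have L_ge: "L (s n) \<ge> 2 ^ n" for n
  proof (induction n)
    case (Suc n)
    then show ?case using neg[OF s_ge[of n]] by (simp add: s_Suc)
  qed (use ge1[of r0] r0 in \<open>simp add: s_0\<close>)
  have s_le: "s n \<le> r0 * exp (2 - 2 / 2 ^ n)" for n
  proof (induction n)
    case (Suc n)
    have "1 + 1 / L (s n) \<le> exp (1 / L (s n))" by (rule exp_ge_add_one_self)
    also have "\<dots> \<le> exp (1 / 2 ^ n)"
      using L_ge[of n] by (simp add: frac_le)
    finally have "s (Suc n) \<le> (r0 * exp (2 - 2 / 2 ^ n)) * exp (1 / 2 ^ n)"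
      unfolding s_Suc using Suc r0 s_ge[of n] ge1[of "s n"] by (intro mult_mono) auto
    also have "\<dots> = r0 * exp (2 - 2 / 2 ^ Suc n)"
      by (simp add: exp_add[symmetric])
    finally show ?case .
  qed (simp add: s_0)
  have "2 ^ n \<le> L (r0 * exp 2)" for n
  proof -
    have "s n \<le> r0 * exp 2"
      by (rule order_trans[OF s_le]) (use r0 in auto)
    then have "L (s n) \<le> L (r0 * exp 2)" using s_ge[of n] r0 by (intro mono) auto
    with L_ge[of n] show ?thesis by linarith
  qed
  moreover obtain n :: nat where "L (r0 * exp 2) < 2 ^ n"
    using real_arch_pow[of 2 "L (r0 * exp 2)"] by auto
  ultimately show False by (meson not_le)
qed

text \<open>
  A sequence of radii \<open>r n\<close> with a reference size \<open>L n\<close>, which in the application is the logarithm of the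
  maximum modulus on the disc of radius \<open>r n\<close>.
\<close>
locale growth_scale =
  fixes r L :: "nat \<Rightarrow> real"
  assumes r: "\<And>n. r n \<ge> 1" and L: "\<And>n. L n \<ge> 1" and L_at_top: "filterlim L at_top sequentially"
begin

text \<open>
  Logarithmic modulus of order at most \<open>L n\<close>, on all discs whose radius is a little below
  \<open>r n (1 + 1 / L n)\<close>. The constant may depend on the disc: passing to a derivative costs a slightly larger disc, so this
  quantification over \<open>s\<close> makes the small functions a differential ring.
\<close>
definition small :: "(complex \<Rightarrow> complex) \<Rightarrow> bool" where
  "small h \<longleftrightarrow> h holomorphic_on UNIV \<and>
     (\<forall>s\<in>{0..<1}. \<exists>C\<ge>0. \<forall>n z. norm z \<le> r n * (1 + s / L n) \<longrightarrow> norm (h z) \<le> exp (C * L n))"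

lemma smallI:
  assumes "h holomorphic_on UNIV"
    and "\<And>s. 0 \<le> s \<Longrightarrow> s < 1 \<Longrightarrow> \<exists>C\<ge>0. \<forall>n z. norm z \<le> r n * (1 + s / L n) \<longrightarrow> norm (h z) \<le> exp (C * L n)"
  shows "small h"
  using assms by (auto simp: small_def)

lemma smallE:
  assumes "small h" "0 \<le> s" "s < 1"
  obtains C where "C \<ge> 0" "\<And>n z. norm z \<le> r n * (1 + s / L n) \<Longrightarrow> norm (h z) \<le> exp (C * L n)"
  using assms that unfolding small_def by (meson atLeastLessThan_iff)

lemma small_holomorphic: "small h \<Longrightarrow> h holomorphic_on A"
  using holomorphic_on_subset by (auto simp: small_def)

lemma small_const: "small (\<lambda>_. c)"
proof (rule smallI)
  have "norm c \<le> exp (norm c * L n)" for n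
  proof -
    have "norm c * 1 \<le> norm c * L n" using L by (intro mult_left_mono) auto
    moreover have "1 + norm c * L n \<le> exp (norm c * L n)" by (rule exp_ge_add_one_self)
    ultimately show ?thesis by linarith
  qed
  then show "\<exists>C\<ge>0. \<forall>n z. norm z \<le> r n * (1 + s / L n) \<longrightarrow> norm c \<le> exp (C * L n)" for s
    by (intro exI[of _ "norm c"]) auto
qed auto

lemma small_add:
  assumes "small f" "small g"
  shows "small (\<lambda>z. f z + g z)"
proof (rule smallI)
  show "(\<lambda>z. f z + g z) holomorphic_on UNIV"
    by (intro holomorphic_intros small_holomorphic assms)
  fix s :: real assume s: "0 \<le> s" "s < 1"
  obtain C where C: "C \<ge> 0" "\<And>n z. norm z \<le> r n * (1 + s / L n) \<Longrightarrow> norm (f z) \<le> exp (C * L n)"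
    using smallE[OF assms(1) s] by blast
  obtain D where D: "D \<ge> 0" "\<And>n z. norm z \<le> r n * (1 + s / L n) \<Longrightarrow> norm (g z) \<le> exp (D * L n)"
    using smallE[OF assms(2) s] by blast
  have "norm (f z + g z) \<le> exp ((C + D + 1) * L n)" if "norm z \<le> r n * (1 + s / L n)" for n z
  proof -
    have l: "0 \<le> C * L n" "0 \<le> D * L n" using C D L[of n] by auto
    have "norm (f z + g z) \<le> exp (C * L n) + exp (D * L n)"
      using C(2)[OF that] D(2)[OF that] norm_triangle_ineq[of "f z" "g z"] by linarith
    also have "\<dots> \<le> exp (C * L n + D * L n) + exp (C * L n + D * L n)"
      using l by (intro add_mono) auto
    also have "\<dots> = 2 * exp (C * L n + D * L n)" by simp
    also have "\<dots> \<le> exp (L n) * exp (C * L n + D * L n)"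
    proof (rule mult_right_mono)
      show "2 \<le> exp (L n)" using exp_ge_add_one_self[of "L n"] L[of n] by linarith
    qed simp
    finally show ?thesis by (simp add: exp_add[symmetric] algebra_simps)
  qed
  then show "\<exists>C\<ge>0. \<forall>n z. norm z \<le> r n * (1 + s / L n) \<longrightarrow> norm (f z + g z) \<le> exp (C * L n)"
    using C D by (intro exI[of _ "C + D + 1"]) auto
qed

lemma small_mult:
  assumes "small f" "small g"
  shows "small (\<lambda>z. f z * g z)"
proof (rule smallI)
  show "(\<lambda>z. f z * g z) holomorphic_on UNIV"
    by (intro holomorphic_intros small_holomorphic assms)
  fix s :: real assume s: "0 \<le> s" "s < 1"
  obtain C where C: "C \<ge> 0" "\<And>n z. norm z \<le> r n * (1 + s / L n) \<Longrightarrow> norm (f z) \<le> exp (C * L n)"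
    using smallE[OF assms(1) s] by blast
  obtain D where D: "D \<ge> 0" "\<And>n z. norm z \<le> r n * (1 + s / L n) \<Longrightarrow> norm (g z) \<le> exp (D * L n)"
    using smallE[OF assms(2) s] by blast
  have "norm (f z * g z) \<le> exp ((C + D) * L n)" if "norm z \<le> r n * (1 + s / L n)" for n z
  proof -
    have "norm (f z * g z) \<le> exp (C * L n) * exp (D * L n)"
      unfolding norm_mult by (intro mult_mono C(2) D(2) that) auto
    then show ?thesis by (simp add: exp_add[symmetric] algebra_simps)
  qed
  then show "\<exists>C\<ge>0. \<forall>n z. norm z \<le> r n * (1 + s / L n) \<longrightarrow> norm (f z * g z) \<le> exp (C * L n)"
    using C D by (intro exI[of _ "C + D"]) auto
qed

lemma small_power: "small f \<Longrightarrow> small (\<lambda>z. f z ^ m)"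
  by (induction m) (auto intro: small_const small_mult)

lemma small_diff:
  assumes "small f" "small g"
  shows "small (\<lambda>z. f z - g z)"
  using small_add[OF assms(1) small_mult[OF small_const[of "-1"] assms(2)]] by simp

lemma small_deriv:
  assumes "small f"
  shows "small (deriv f)"
proof (rule smallI)
  show "deriv f holomorphic_on UNIV"
    by (intro holomorphic_intros small_holomorphic assms) auto
  fix s :: real assume s: "0 \<le> s" "s < 1"
  define t where "t = (1 + s) / 2"
  have t: "0 \<le> t" "t < 1" "s < t" using s by (auto simp: t_def)
  obtain C where C: "C \<ge> 0" "\<And>n z. norm z \<le> r n * (1 + t / L n) \<Longrightarrow> norm (f z) \<le> exp (C * L n)"
    using smallE[OF assms t(1,2)] by blast
  define K where "K = 1 / (t - s)"
  have K: "K > 0" using t by (simp add: K_def)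
  have "norm (deriv f z) \<le> exp ((C + 1 + K) * L n)" if z: "norm z \<le> r n * (1 + s / L n)" for n z
  proof -
    define d where "d = r n * (t - s) / L n"
    have Ln: "L n \<ge> 1" and rn: "r n \<ge> 1" by (rule L, rule r)
    have d: "d > 0" using Ln rn t by (simp add: d_def)
    have "norm ((deriv ^^ 1) f z) \<le> fact 1 * exp (C * L n) / d ^ 1"
    proof (rule Cauchy_inequality)
      show "f holomorphic_on ball z d" by (rule small_holomorphic[OF assms])
      show "continuous_on (cball z d) f"
        by (rule holomorphic_on_imp_continuous_on[OF small_holomorphic[OF assms]])
      fix x assume "norm (z - x) = d"
      then have "norm x \<le> norm z + d" using norm_triangle_ineq4[of z "z - x"] by simp
      also have "\<dots> \<le> r n * (1 + s / L n) + d" using z by simp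
      also have "\<dots> = r n * (1 + t / L n)" using Ln by (simp add: d_def field_simps)
      finally show "norm (f x) \<le> exp (C * L n)" by (rule C)
    qed (use d in auto)
    then have "norm (deriv f z) \<le> exp (C * L n) * (1 / d)" by simp
    also have "1 / d = (L n * K) / r n" by (simp add: d_def K_def)
    also have "\<dots> \<le> (L n * K) / 1" using rn Ln K by (intro divide_left_mono) auto
    also have "(L n * K) / 1 = L n * K" by simp
    also have "L n * K \<le> exp (L n) * exp (K * L n)"
    proof (rule mult_mono)
      show "L n \<le> exp (L n)" using exp_ge_add_one_self[of "L n"] by linarith
      have "K * 1 \<le> K * L n" using K Ln by (intro mult_left_mono) auto
      then show "K \<le> exp (K * L n)" using exp_ge_add_one_self[of "K * L n"] by linarith
    qed (use K in auto)
    finally show ?thesis by (simp add: exp_add[symmetric] algebra_simps)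
  qed
  then show "\<exists>C\<ge>0. \<forall>n z. norm z \<le> r n * (1 + s / L n) \<longrightarrow> norm (deriv f z) \<le> exp (C * L n)"
    using C K by (intro exI[of _ "C + 1 + K"]) auto
qed

lemmas small_intros = small_const small_add small_diff small_mult small_power small_deriv

end

text \<open>
  Allows \<open>Jensen_bound\<close> to be applied to a function that vanishes at the centre.
\<close>
lemma entire_factor_zero:
  fixes h :: "complex \<Rightarrow> complex"
  assumes hol: "h holomorphic_on UNIV" and nz: "h \<xi> \<noteq> 0"
  obtains m g where "g holomorphic_on UNIV" "g 0 \<noteq> 0" "\<And>z. h z = z ^ m * g z"
proof -
  have ex: "\<exists>n. (deriv ^^ n) h 0 \<noteq> 0"
  proof (rule ccontr)
    assume "\<nexists>n. (deriv ^^ n) h 0 \<noteq> 0"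
    then have "h \<xi> = 0"
      by (intro holomorphic_fun_eq_0_on_connected[OF hol]) auto
    with nz show False by simp
  qed
  define m where "m = (LEAST n. (deriv ^^ n) h 0 \<noteq> 0)"
  have m: "(deriv ^^ m) h 0 \<noteq> 0" "\<And>i. i < m \<Longrightarrow> (deriv ^^ i) h 0 = 0"
    using LeastI_ex[OF ex] not_less_Least unfolding m_def by blast+
  show ?thesis
  proof (cases "m = 0")
    case True
    then show ?thesis using that[of h 0] hol m(1) by simp
  next
    case False
    obtain g \<epsilon> where g: "0 < \<epsilon>" "g holomorphic_on ball 0 \<epsilon>"
      "\<And>w. w \<in> ball 0 \<epsilon> \<Longrightarrow> h w - h 0 = (w - 0) ^ m * g w" "\<And>w. w \<in> ball 0 \<epsilon> \<Longrightarrow> g w \<noteq> 0"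
      by (rule holomorphic_factor_order_of_zero[OF hol open_UNIV UNIV_I _ m(1)]) (use m(2) False in blast)+
    have h0: "h 0 = 0" using m(2)[of 0] False by simp
    define q where "q z = (if z = 0 then g 0 else h z / z ^ m)" for z
    have qg: "q z = g z" if "z \<in> ball 0 \<epsilon>" for z
      using g(3)[OF that] h0 by (simp add: q_def)
    have "q holomorphic_on UNIV"
    proof (rule no_isolated_singularity'[where K = "{0}"])
      have "isCont g 0"
        using g(1,2) by (intro continuous_on_interior[of "ball 0 \<epsilon>"] holomorphic_on_imp_continuous_on) auto
      then have "(g \<longlongrightarrow> q 0) (at 0)" by (simp add: isCont_def q_def)
      moreover have "eventually (\<lambda>z. g z = q z) (at 0)"
        using eventually_at_in_open'[of "ball 0 \<epsilon>" 0] g(1) by (auto elim!: eventually_mono simp: qg)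
      ultimately show "(q \<longlongrightarrow> q z) (at z within UNIV)" if "z \<in> {0}" for z
        using that by (auto intro: Lim_transform_eventually)
      have "(\<lambda>z. h z / z ^ m) holomorphic_on UNIV - {0}"
        by (intro holomorphic_intros holomorphic_on_subset[OF hol]) auto
      then show "q holomorphic_on UNIV - {0}"
        by (rule holomorphic_transform) (auto simp: q_def)
    qed auto
    moreover have "q 0 \<noteq> 0" using g(1,4) by (simp add: q_def)
    moreover have "h z = z ^ m * q z" for z
      using h0 False by (simp add: q_def)
    ultimately show ?thesis using that by blast
  qed
qed

section \<open>Exponentials over the small functions\<close>

lemma holomorphic_mult_eq_0:
  assumes "f holomorphic_on UNIV" "g holomorphic_on UNIV" "\<And>z. f z * g z = 0" "f \<xi> \<noteq> 0"
  shows "g z = 0"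
proof -
  have "isCont f \<xi>"
    using assms(1) holomorphic_on_imp_continuous_on continuous_on_eq_continuous_at open_UNIV by blast
  then have "eventually (\<lambda>z. f z \<noteq> 0) (at \<xi>)"
    using assms(4) by (auto simp: isCont_def intro: tendsto_imp_eventually_ne)
  then obtain d where d: "d > 0" "\<And>z. dist z \<xi> < d \<Longrightarrow> f z \<noteq> 0"
    unfolding eventually_at using assms(4) by (metis UNIV_I)
  have g0: "g z = 0" if "z \<in> ball \<xi> d" for z
    using assms(3)[of z] d(2)[of z] that by (auto simp: dist_commute)
  show ?thesis
    by (rule analytic_continuation_open[of "ball \<xi> d" UNIV g "\<lambda>_. 0" z])
       (use assms(2) g0 d(1) in auto)
qed

context growth_scale
begin

text \<open>
  Infinitely often on the scale, \<open>\<gamma>\<close> reaches the size \<open>exp (L n)\<close> up to a constant factor. The subtracted 3 comes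
  from the normalisation \<open>exp (L n) = 3 + max (\<bar>\<gamma>\<bar> + \<bar>\<delta>\<bar>)\<close> that is chosen below to ensure \<open>L n \<ge> 1\<close>.
\<close>
definition dominant :: "(complex \<Rightarrow> complex) \<Rightarrow> bool" where
  "dominant \<gamma> \<longleftrightarrow> \<gamma> holomorphic_on UNIV \<and>
     (\<exists>\<^sub>F n in sequentially. \<exists>z. norm z \<le> r n \<and> norm (\<gamma> z) \<ge> (exp (L n) - 3) / 2)"

text \<open>
  Between the radii \<open>r n\<close> and \<open>R\<close> the Borel-Caratheodory factor \<open>R / (R - \<bar>z\<bar>)\<close> is at most \<open>3 L n\<close>, so the
  mean of the positive part of \<open>Re \<gamma>\<close> is at least of order \<open>exp (L n) / L n\<close>, on every rotation of the circle.
\<close>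
lemma dominant_circle_mean:
  assumes \<gamma>: "\<gamma> holomorphic_on UNIV" and z: "norm z \<le> r n" "norm (\<gamma> z) \<ge> (exp (L n) - 3) / 2"
  defines "R \<equiv> r n * (1 + (1/2) / L n)"
  shows "(((exp (L n) - 3) / 2 - norm (\<gamma> 0)) / (6 * L n) - norm (\<gamma> 0)) / 2 \<le>
     integral {0..1} (\<lambda>t. max 0 (Re (\<gamma> (of_real R * unit_cis (s + t)))))"
    (is "_ \<le> ?I")
proof -
  have rn: "r n \<ge> 1" and Ln: "L n \<ge> 1" by (rule r, rule L)
  have rR: "r n < R" using rn Ln by (simp add: R_def)
  define g where "g w = \<gamma> (w * unit_cis s)" for w
  define w where "w = z / unit_cis s"
  have nw: "norm w = norm z" by (simp add: w_def norm_divide)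
  have g: "g holomorphic_on cball 0 R"
    unfolding g_def
    by (rule holomorphic_on_compose_gen[OF _ \<gamma>, unfolded o_def]) (auto intro!: holomorphic_intros)
  have "norm w < R" using nw z(1) rR by simp
  from Borel_Caratheodory_mean[OF g this]
  have "norm (\<gamma> z) \<le> norm (\<gamma> 0) + 2 * (R / (R - norm z)) * (2 * ?I + norm (\<gamma> 0))"
    unfolding nw by (simp add: g_def w_def unit_cis_add mult_ac)
  also have "\<dots> \<le> norm (\<gamma> 0) + 2 * (3 * L n) * (2 * ?I + norm (\<gamma> 0))"
  proof (intro add_left_mono mult_right_mono mult_left_mono)
    have "R / (R - norm z) \<le> R / (R - r n)"
      using z(1) rR rn by (intro divide_left_mono mult_pos_pos) auto
    also have "R / (R - r n) = 2 * L n + 1"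
      using rn Ln by (simp add: R_def field_simps)
    also have "\<dots> \<le> 3 * L n" using Ln by simp
    finally show "R / (R - norm z) \<le> 3 * L n" .
    have "continuous_on UNIV (\<lambda>t. \<gamma> (of_real R * unit_cis (s + t)))"
      by (rule continuous_on_compose2[OF holomorphic_on_imp_continuous_on[OF \<gamma>]])
         (auto intro!: continuous_intros)
    then have "continuous_on {0..1} (\<lambda>t. \<gamma> (of_real R * unit_cis (s + t)))"
      using continuous_on_subset by blast
    then have "0 \<le> ?I"
      by (intro integral_nonneg integrable_continuous_interval continuous_intros) auto
    then show "0 \<le> 2 * ?I + norm (\<gamma> 0)" by simp
  qed auto
  finally have "(exp (L n) - 3) / 2 - norm (\<gamma> 0) \<le> (2 * ?I + norm (\<gamma> 0)) * (6 * L n)"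
    using z(2) by (simp add: algebra_simps)
  then have "((exp (L n) - 3) / 2 - norm (\<gamma> 0)) / (6 * L n) \<le> 2 * ?I + norm (\<gamma> 0)"
    using Ln by (subst pos_divide_le_eq) auto
  then show ?thesis by simp
qed

text \<open>
  Where \<open>exp x\<close> is large, the top coefficient is balanced by lower powers and must be small.
\<close>
lemma top_coefficient_bound:
  fixes c :: "nat \<Rightarrow> complex" and x :: complex
  assumes sum0: "(\<Sum>j\<le>N. c j * exp x ^ j) = 0" and N: "N > 0" and B: "\<And>j. j \<le> N \<Longrightarrow> norm (c j) \<le> B"
  shows "norm (c N) \<le> real N * B * exp (- max 0 (Re x))"
proof (cases "Re x \<ge> 0")
  case False
  have "norm (c N) \<le> 1 * B" using B[of N] by simp
  also have "\<dots> \<le> real N * B" 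
    using N B[of N] order_trans[OF norm_ge_zero B[of N]] by (intro mult_right_mono) auto
  finally show ?thesis using False by simp
next
  case True
  obtain M where M: "N = Suc M" using N gr0_implies_Suc by blast
  define X where "X = exp (Re x)"
  have X: "X \<ge> 1" using True by (simp add: X_def)
  have "{..N} = insert N {..<N}" by auto
  then have "c N * exp x ^ N = - (\<Sum>j<N. c j * exp x ^ j)"
    using sum0 by (simp add: eq_neg_iff_add_eq_0)
  then have "norm (c N * exp x ^ N) = norm (\<Sum>j<N. c j * exp x ^ j)" by simp
  also have "\<dots> \<le> (\<Sum>j<N. B * X ^ M)"
  proof (rule sum_norm_le)
    fix j assume j: "j \<in> {..<N}"
    have "norm (c j * exp x ^ j) = norm (c j) * X ^ j" by (simp add: norm_mult norm_power X_def)
    also have "\<dots> \<le> B * X ^ M"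
      using B[of j] j M X order_trans[OF norm_ge_zero B[of N]] by (intro mult_mono power_increasing) auto
    finally show "norm (c j * exp x ^ j) \<le> B * X ^ M" .
  qed
  also have "\<dots> = real N * B * X ^ M" by simp
  finally have "norm (c N) * X * X ^ M \<le> real N * B * X ^ M"
    by (simp add: norm_mult norm_power X_def M mult_ac)
  then have "norm (c N) * X \<le> real N * B"
    by (rule mult_right_le_imp_le) (use X in auto)
  then have "norm (c N) \<le> real N * B / X"
    using X by (subst pos_le_divide_eq) auto
  then show ?thesis using True by (simp add: X_def exp_minus field_simps)
qed

text \<open>
  The top coefficient has size at most \<open>exp (O(L))\<close> times \<open>exp (- max 0 (Re \<gamma>))\<close> on a circle, where the mean of
  \<open>max 0 (Re \<gamma>)\<close> exceeds any multiple of \<open>L\<close>. If it were not identically zero, Jensen's inequality would push its first nonzero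
  Taylor coefficient at 0 below every positive bound.
\<close>
lemma top_coefficient_zero:
  assumes \<gamma>: "dominant \<gamma>"
    and c: "\<And>j. j \<le> N \<Longrightarrow> small (c j)" and sum0: "\<And>z. (\<Sum>j\<le>N. c j z * exp (\<gamma> z) ^ j) = 0"
  shows "c N \<xi> = 0"
proof (cases "N = 0")
  case True
  then show ?thesis using sum0[of \<xi>] by simp
next
  case False
  show ?thesis
  proof (rule ccontr)
    assume nz: "c N \<xi> \<noteq> 0"
    obtain m h where h: "h holomorphic_on UNIV" "h 0 \<noteq> 0" "\<And>z. c N z = z ^ m * h z"
      by (rule entire_factor_zero[OF small_holomorphic[OF c[OF order_refl]] nz], rule that)
    have "\<forall>j. \<exists>C. j \<le> N \<longrightarrow> C \<ge> 0 \<and>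
        (\<forall>n z. norm z \<le> r n * (1 + (1/2) / L n) \<longrightarrow> norm (c j z) \<le> exp (C * L n))"
    proof
      fix j
      show "\<exists>C. j \<le> N \<longrightarrow> C \<ge> 0 \<and> (\<forall>n z. norm z \<le> r n * (1 + (1/2) / L n) \<longrightarrow> norm (c j z) \<le> exp (C * L n))"
      proof (cases "j \<le> N")
        case True
        obtain C where "C \<ge> 0" "\<And>n z. norm z \<le> r n * (1 + (1/2) / L n) \<Longrightarrow> norm (c j z) \<le> exp (C * L n)"
          by (rule smallE[OF c[OF True], of "1/2"]) auto
        then show ?thesis by blast
      qed simp
    qed
    from choice[OF this] obtain C where C: "\<And>j. j \<le> N \<Longrightarrow> C j \<ge> 0" 
      "\<And>j n z. j \<le> N \<Longrightarrow> norm z \<le> r n * (1 + (1/2) / L n) \<Longrightarrow> norm (c j z) \<le> exp (C j * L n)"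
      by blast
    define D where "D = (\<Sum>j\<le>N. C j)"
    define G where "G = norm (\<gamma> 0)"
    define \<mu> where "\<mu> l = (((exp l - 3) / 2 - G) / (6 * l) - G) / 2" for l
    have cD: "norm (c j z) \<le> exp (D * L n)" if "j \<le> N" "norm z \<le> r n * (1 + (1/2) / L n)" for j n z
    proof -
      have "C j \<le> D" unfolding D_def using that C(1) by (intro member_le_sum) auto
      then have "exp (C j * L n) \<le> exp (D * L n)" using L[of n] by (simp add: mult_right_mono)
      with C(2)[OF that] show ?thesis by linarith
    qed
    have bound: "norm (h 0) \<le> real N * exp (D * L n) * exp (1 - \<mu> (L n))"
      if ex: "\<exists>z. norm z \<le> r n \<and> norm (\<gamma> z) \<ge> (exp (L n) - 3) / 2" for n
    proof -
      define R where "R = r n * (1 + (1/2) / L n)"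
      have "1 * 1 \<le> R" unfolding R_def using r[of n] L[of n] by (intro mult_mono) auto
      then have R: "R \<ge> 1" by simp
      have hol\<gamma>: "\<gamma> holomorphic_on UNIV" using \<gamma> by (simp add: dominant_def)
      show ?thesis
      proof (rule Jensen_bound[where R = R and \<psi> = "\<lambda>z. max 0 (Re (\<gamma> z))"])
        show "h holomorphic_on cball 0 R" using h(1) holomorphic_on_subset by blast
        show "continuous_on (sphere 0 R) (\<lambda>z. max 0 (Re (\<gamma> z)))"
          by (intro continuous_intros holomorphic_on_imp_continuous_on holomorphic_on_subset[OF hol\<gamma>]) auto
        fix z :: complex assume z: "norm z = R"
        have "1 * norm (h z) \<le> norm z ^ m * norm (h z)"
          using R z by (intro mult_right_mono one_le_power) auto
        then have "norm (h z) \<le> norm (c N z)" by (simp add: h(3) norm_mult norm_power)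
        also have "\<dots> \<le> real N * exp (D * L n) * exp (- max 0 (Re (\<gamma> z)))"
          by (rule top_coefficient_bound[OF sum0]) (use False cD z in \<open>auto simp: R_def\<close>)
        finally show "norm (h z) \<le> real N * exp (D * L n) * exp (- max 0 (Re (\<gamma> z)))" .
      next
        fix s :: real
        from ex obtain z where "norm z \<le> r n" "norm (\<gamma> z) \<ge> (exp (L n) - 3) / 2" by blast
        from dominant_circle_mean[OF hol\<gamma> this, of s]
        show "\<mu> (L n) \<le> integral {0..1} (\<lambda>t. max 0 (Re (\<gamma> (of_real R * unit_cis (s + t)))))"
          unfolding \<mu>_def G_def R_def .
      qed (use R False in auto)
    qed
    have "((\<lambda>l. real N * exp (D * l) * exp (1 - \<mu> l)) \<longlongrightarrow> 0) at_top"
    proof -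
      have "filterlim (\<lambda>l. \<mu> l - D * l) at_top at_top"
        unfolding \<mu>_def by real_asymp
      then have "((\<lambda>l. exp (- (\<mu> l - D * l))) \<longlongrightarrow> 0) at_top"
        by (intro filterlim_compose[OF exp_at_bot]) (simp add: filterlim_uminus_at_top)
      then have "((\<lambda>l. real N * exp 1 * exp (- (\<mu> l - D * l))) \<longlongrightarrow> 0) at_top"
        by (rule tendsto_mult_right_zero)
      then show ?thesis by (simp add: exp_add[symmetric] mult.assoc algebra_simps)
    qed
    then have "((\<lambda>n. real N * exp (D * L n) * exp (1 - \<mu> (L n))) \<longlongrightarrow> 0) sequentially"
      by (rule filterlim_compose[OF _ L_at_top])
    then have ev: "eventually (\<lambda>n. real N * exp (D * L n) * exp (1 - \<mu> (L n)) < norm (h 0)) sequentially"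
      by (rule order_tendstoD) (use h(2) in simp)
    have freq: "\<exists>\<^sub>F n in sequentially. \<exists>z. norm z \<le> r n \<and> norm (\<gamma> z) \<ge> (exp (L n) - 3) / 2"
      using \<gamma> by (simp add: dominant_def)
    obtain n where "\<exists>z. norm z \<le> r n \<and> norm (\<gamma> z) \<ge> (exp (L n) - 3) / 2"
      "real N * exp (D * L n) * exp (1 - \<mu> (L n)) < norm (h 0)"
      using frequently_ex[OF frequently_eventually_frequently[OF freq ev]] by blast
    with bound[of n] show False by (meson not_le)
  qed
qed

lemma exp_transcendental_over_small:
  assumes \<gamma>: "dominant \<gamma>"
    and "\<And>j. j \<le> N \<Longrightarrow> small (c j)" and "\<And>z. (\<Sum>j\<le>N. c j z * exp (\<gamma> z) ^ j) = 0" and "j \<le> N"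
  shows "c j z = 0"
  using assms(2-)
proof (induction N)
  case 0
  then show ?case using top_coefficient_zero[OF \<gamma>, of 0 c] by simp
next
  case (Suc N)
  have top: "c (Suc N) z = 0" for z by (rule top_coefficient_zero[OF \<gamma> Suc.prems(1,2)])
  show ?case
  proof (cases "j = Suc N")
    case False
    have "(\<Sum>j\<le>N. c j z * exp (\<gamma> z) ^ j) = 0" for z
      using Suc.prems(2)[of z] top by simp
    then show ?thesis using False Suc.prems by (intro Suc.IH) auto
  qed (use top in simp)
qed

text \<open>
  Write \<open>X = exp \<gamma>\<close>, \<open>Y = exp \<delta>\<close>. The relation and its derivative are two quadratic equations for \<open>Y\<close> over the ring
  generated by \<open>X\<close> and small functions. Eliminating \<open>Y\<^sup>2\<close> expresses \<open>Y\<close> by \<open>X\<close>, and substitution gives a quartic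
  equation for \<open>X\<close> with small coefficients. All of these vanish since \<open>X\<close> is transcendental over the small functions: the
  coefficient of \<open>X\<^sup>4\<close> gives \<open>a = 0\<close>, and those of \<open>X\<^sup>2\<close> and \<open>X\<close> then determine \<open>b\<^sup>2\<close> and \<open>b\<close>,
  consistently only if \<open>R = S\<close>.
\<close>
lemma quadratic_relation_forces_equality:
  assumes dom: "dominant \<gamma>" and R: "small R" and S: "small S" and g: "small \<gamma>" and d: "small \<delta>" and \<eta>: "\<eta> \<noteq> 0"
    and eq: "\<And>z. (exp (\<gamma> z) + \<eta>) * (exp (\<gamma> z) * R z) = (exp (\<delta> z) + \<eta>) * (exp (\<delta> z) * S z)"
    and R0: "R \<xi> \<noteq> 0" and S0: "S \<xi>' \<noteq> 0" and d0: "deriv \<delta> \<xi>'' \<noteq> 0"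
  shows "R z = S z"
proof -
  note hol = small_holomorphic[OF R] small_holomorphic[OF S] small_holomorphic[OF g] small_holomorphic[OF d]
  define A where "A z = deriv R z + 2 * deriv \<gamma> z * R z" for z
  define B where "B z = deriv R z + deriv \<gamma> z * R z" for z
  define C where "C z = deriv S z + 2 * deriv \<delta> z * S z" for z
  define e where "e z = deriv \<delta> z" for z
  define a where "a z = C z * R z - S z * A z" for z
  define b where "b z = \<eta> * (C z * R z - S z * B z)" for z
  have sm: "small A" "small B" "small C" "small e"
    unfolding A_def[abs_def] B_def[abs_def] C_def[abs_def] e_def[abs_def] by (intro small_intros R S g d)+
  have sa: "small a" "small b" unfolding a_def[abs_def] b_def[abs_def] by (intro small_intros sm R S)+
  have deriv_eq: "A z * exp (\<gamma> z) ^ 2 + \<eta> * B z * exp (\<gamma> z) = 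
     C z * exp (\<delta> z) ^ 2 + \<eta> * (deriv S z + deriv \<delta> z * S z) * exp (\<delta> z)" for z
  proof -
    have D: "(R has_field_derivative deriv R z) (at z)" "(S has_field_derivative deriv S z) (at z)"
      "(\<gamma> has_field_derivative deriv \<gamma> z) (at z)" "(\<delta> has_field_derivative deriv \<delta> z) (at z)"
      using hol by (auto intro!: holomorphic_derivI[where S = UNIV])
    have "((\<lambda>z. (exp (\<gamma> z) + \<eta>) * (exp (\<gamma> z) * R z)) has_field_derivative 
       A z * exp (\<gamma> z) ^ 2 + \<eta> * B z * exp (\<gamma> z)) (at z)"
      by (rule derivative_eq_intros D refl)+ (simp add: A_def B_def algebra_simps power2_eq_square)
    moreover have "((\<lambda>z. (exp (\<delta> z) + \<eta>) * (exp (\<delta> z) * S z)) has_field_derivative 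
       C z * exp (\<delta> z) ^ 2 + \<eta> * (deriv S z + deriv \<delta> z * S z) * exp (\<delta> z)) (at z)"
      by (rule derivative_eq_intros D refl)+ (simp add: C_def algebra_simps power2_eq_square)
    ultimately show ?thesis using DERIV_unique by (simp add: eq)
  qed
  \<comment> \<open>the coefficients of the quartic in \<open>X\<close>\<close>
  define co where "co j = (if j = 4 then (\<lambda>z. a z ^ 2) else if j = 3 then (\<lambda>z. 2 * a z * b z)
     else if j = 2 then (\<lambda>z. b z ^ 2 + \<eta> ^ 2 * e z * S z ^ 2 * a z - \<eta> ^ 2 * e z ^ 2 * S z ^ 3 * R z)
     else if j = 1 then (\<lambda>z. \<eta> ^ 2 * e z * S z ^ 2 * b z - \<eta> ^ 3 * e z ^ 2 * S z ^ 3 * R z) else (\<lambda>_. 0))"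
    for j :: nat
  have "small (co j)" for j
    unfolding co_def by (cases "j = 4"; cases "j = 3"; cases "j = 2"; cases "j = 1")
      (auto intro!: small_intros sm sa R S)
  moreover have "(\<Sum>j\<le>4. co j z * exp (\<gamma> z) ^ j) = 0" for z
  proof -
    define X Y where "X = exp (\<gamma> z)" and "Y = exp (\<delta> z)"
    have E: "(X + \<eta>) * (X * R z) = (Y + \<eta>) * (Y * S z)" using eq[of z] by (simp add: X_def Y_def)
    have E': "A z * X ^ 2 + \<eta> * B z * X = C z * Y ^ 2 + \<eta> * (deriv S z + e z * S z) * Y"
      using deriv_eq[of z] by (simp add: X_def Y_def e_def)
    have C: "C z = deriv S z + 2 * e z * S z" by (simp add: C_def e_def)
    \<comment> \<open>elimination of \<open>Y\<^sup>2\<close> between the relation and its derivative\<close>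
    have lin: "a z * X ^ 2 + b z * X = \<eta> * e z * S z ^ 2 * Y"
    proof -
      have "a z * X ^ 2 + b z * X = C z * ((X + \<eta>) * (X * R z)) - S z * (A z * X ^ 2 + \<eta> * B z * X)"
        by (simp add: a_def b_def algebra_simps power2_eq_square)
      also have "\<dots> = C z * ((Y + \<eta>) * (Y * S z)) - S z * (C z * Y ^ 2 + \<eta> * (deriv S z + e z * S z) * Y)"
        by (simp only: E E')
      also have "\<dots> = \<eta> * e z * S z ^ 2 * Y"
        unfolding C by (simp add: algebra_simps power2_eq_square)
      finally show ?thesis .
    qed
    \<comment> \<open>the relation multiplied by \<open>\<eta>\<^sup>2 e\<^sup>2 S\<^sup>3\<close>, with \<open>Y\<close> replaced according to \<open>lin\<close>\<close>
    have "(\<Sum>j\<le>4. co j z * X ^ j) = (a z * X ^ 2 + b z * X) ^ 2 + \<eta> ^ 2 * e z * S z ^ 2 * (a z * X ^ 2 + b z * X)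
        - \<eta> ^ 2 * e z ^ 2 * S z ^ 3 * ((X + \<eta>) * (X * R z))"
      by (simp add: co_def numeral_eq_Suc algebra_simps)
    also have "\<dots> = 0"
      unfolding lin E by (simp add: algebra_simps power2_eq_square power3_eq_cube)
    finally show ?thesis by (simp add: X_def)
  qed
  ultimately have co0: "co j z = 0" if "j \<le> 4" for j z
    using exp_transcendental_over_small[OF dom, of 4 co j z] that by blast
  have a0: "a z = 0" for z using co0[of 4 z] by (simp add: co_def)
  have b1: "b z ^ 2 = \<eta> ^ 2 * e z ^ 2 * S z ^ 3 * R z" for z
    using co0[of 2 z] a0[of z] by (simp add: co_def)
  have b2: "\<eta> ^ 2 * e z * S z ^ 2 * (b z - \<eta> * e z * S z * R z) = 0" for z
    using co0[of 1 z] by (simp add: co_def algebra_simps power2_eq_square power3_eq_cube)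
  have prod0: "e z * (S z * (R z * (R z - S z))) = 0" for z
  proof (cases "e z = 0 \<or> S z = 0")
    case False
    then have "b z = \<eta> * e z * S z * R z" using b2[of z] \<eta> by simp
    with b1[of z] have "(\<eta> * e z * S z) ^ 2 * (R z * (R z - S z)) = 0"
      by (simp add: algebra_simps power2_eq_square power3_eq_cube)
    with False \<eta> show ?thesis by simp
  qed auto
  have "e \<xi>'' \<noteq> 0" using d0 by (simp add: e_def)
  note holo = hol small_holomorphic[OF sm(4)]
  have prod1: "S z * (R z * (R z - S z)) = 0" for z
    by (rule holomorphic_mult_eq_0[of e "\<lambda>z. S z * (R z * (R z - S z))", OF _ _ prod0 \<open>e \<xi>'' \<noteq> 0\<close>]) (intro holomorphic_intros holo)+
  have prod2: "R z * (R z - S z) = 0" for z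
    by (rule holomorphic_mult_eq_0[of S "\<lambda>z. R z * (R z - S z)", OF _ _ prod1 S0]) (intro holomorphic_intros holo)+
  have "R z - S z = 0"
    by (rule holomorphic_mult_eq_0[of R "\<lambda>z. R z - S z", OF _ _ prod2 R0]) (intro holomorphic_intros holo)+
  then show ?thesis by simp
qed

end

section \<open>Uniqueness for entire functions with an omitted value\<close>

text \<open>
  The differential polynomial in \<open>\<gamma>\<close> that equals \<open>F\<^sup>(\<^sup>k\<^sup>) / F\<close> for \<open>F = exp \<circ> \<gamma>\<close>.
\<close>
fun log_quotient :: "(complex \<Rightarrow> complex) \<Rightarrow> nat \<Rightarrow> complex \<Rightarrow> complex" where
  "log_quotient \<gamma> 0 = (\<lambda>_. 1)"
| "log_quotient \<gamma> (Suc k) = (\<lambda>z. deriv (log_quotient \<gamma> k) z + deriv \<gamma> z * log_quotient \<gamma> k z)"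

lemma log_quotient_holomorphic:
  assumes "\<gamma> holomorphic_on UNIV"
  shows "log_quotient \<gamma> k holomorphic_on UNIV"
  by (induction k) (auto intro!: holomorphic_intros assms)

lemma higher_deriv_exp:
  assumes "\<gamma> holomorphic_on UNIV"
  shows "(deriv ^^ k) (\<lambda>z. exp (\<gamma> z)) = (\<lambda>z. exp (\<gamma> z) * log_quotient \<gamma> k z)"
proof (induction k)
  case (Suc k)
  have "((\<lambda>z. exp (\<gamma> z) * log_quotient \<gamma> k z) has_field_derivative
          exp (\<gamma> z) * log_quotient \<gamma> (Suc k) z) (at z)" for z
  proof -
    have D: "(\<gamma> has_field_derivative deriv \<gamma> z) (at z)"
      "(log_quotient \<gamma> k has_field_derivative deriv (log_quotient \<gamma> k) z) (at z)"
      using assms log_quotient_holomorphic[OF assms] by (auto intro!: holomorphic_derivI[where S = UNIV])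
    show ?thesis
      by (rule derivative_eq_intros D refl)+ (simp add: algebra_simps)
  qed
  then have "deriv (\<lambda>z. exp (\<gamma> z) * log_quotient \<gamma> k z) = (\<lambda>z. exp (\<gamma> z) * log_quotient \<gamma> (Suc k) z)"
    by (intro ext DERIV_imp_deriv)
  moreover have "(deriv ^^ Suc k) (\<lambda>z. exp (\<gamma> z)) = deriv (\<lambda>z. exp (\<gamma> z) * log_quotient \<gamma> k z)"
    by (simp add: Suc)
  ultimately show ?case by (simp only:)
qed simp

lemma (in growth_scale) small_log_quotient:
  assumes "small \<gamma>"
  shows "small (log_quotient \<gamma> k)"
  by (induction k) (auto intro!: small_intros assms)

text \<open>
  Take \<open>exp (\<Lambda> x) = 3 + max (\<bar>\<gamma>\<bar> + \<bar>\<delta>\<bar>)\<close> on the disc of radius \<open>x\<close> and radii supplied by the growth lemma. Since \<open>\<Lambda>\<close>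
  at most doubles up to \<open>r n (1 + 1 / L n)\<close>, both functions are small, and on each disc one of them carries at least half of
  the maximum. It cannot be prescribed which of the two is dominant.
\<close>
lemma growth_scale_exists:
  fixes \<gamma> \<delta> :: "complex \<Rightarrow> complex"
  assumes hol: "\<gamma> holomorphic_on UNIV" "\<delta> holomorphic_on UNIV" and nonconst: "\<not> \<gamma> constant_on UNIV"
  obtains r L where "growth_scale r L" "growth_scale.small r L \<gamma>" "growth_scale.small r L \<delta>"
    "growth_scale.dominant r L \<gamma> \<or> growth_scale.dominant r L \<delta>"
proof -
  define m where "m z = norm (\<gamma> z) + norm (\<delta> z)" for z
  have cm: "continuous_on A m" for A
    unfolding m_def
    by (intro continuous_intros holomorphic_on_imp_continuous_on holomorphic_on_subset[OF hol(1)] holomorphic_on_subset[OF hol(2)]) auto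
  have "\<exists>w. norm w \<le> x \<and> (\<forall>z. norm z \<le> x \<longrightarrow> m z \<le> m w)" if "x \<ge> 0" for x
    using continuous_attains_sup[OF compact_cball[of 0 x] _ cm] that by auto
  then obtain w where w: "\<And>x. x \<ge> 0 \<Longrightarrow> norm (w x) \<le> x" "\<And>x z. norm z \<le> x \<Longrightarrow> x \<ge> 0 \<Longrightarrow> m z \<le> m (w x)"
    by metis
  define \<Lambda> where "\<Lambda> x = ln (3 + m (w x))" for x
  have m0: "m z \<ge> 0" for z by (simp add: m_def)
  have exp\<Lambda>: "exp (\<Lambda> x) = 3 + m (w x)" for x using m0[of "w x"] by (simp add: \<Lambda>_def)
  have mono: "\<Lambda> x \<le> \<Lambda> y" if "0 \<le> x" "x \<le> y" for x y
    using w(2)[of "w x" y] w(1)[of x] that m0[of "w x"] unfolding \<Lambda>_def by (intro ln_mono) auto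
  have ge1: "\<Lambda> x \<ge> 1" for x
  proof -
    have "exp 1 \<le> exp (\<Lambda> x)" using exp_le m0[of "w x"] unfolding exp\<Lambda> by linarith
    then show ?thesis by simp
  qed
  have "\<exists>x. x \<ge> real n + 1 \<and> \<Lambda> (x * (1 + 1 / \<Lambda> x)) \<le> 2 * \<Lambda> x" for n
    using Borel_growth_lemma[of \<Lambda> "real n + 1"] mono ge1 by (metis add_pos_nonneg add.commute of_nat_0_le_iff zero_less_one)
  then obtain r where rr: "\<And>n. r n \<ge> real n + 1" "\<And>n. \<Lambda> (r n * (1 + 1 / \<Lambda> (r n))) \<le> 2 * \<Lambda> (r n)"
    by metis
  define L where "L n = \<Lambda> (r n)" for n
  have unbounded: "\<exists>z. m z > B" for B
  proof (rule ccontr)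
    assume "\<nexists>z. m z > B"
    then have "norm (\<gamma> z) \<le> B" for z unfolding m_def by (smt (verit) norm_ge_zero)
    then have "bounded (range \<gamma>)" by (auto simp: bounded_iff)
    then have "\<gamma> constant_on UNIV" using Liouville_theorem[OF hol(1)] by (auto simp: constant_on_def)
    with nonconst show False by simp
  qed
  have L_at_top: "filterlim L at_top sequentially"
  proof (subst filterlim_at_top, intro allI)
    fix Z :: real
    obtain z where z: "m z > exp Z" using unbounded by blast
    obtain n0 :: nat where n0: "norm z \<le> real n0" using real_arch_simple by blast
    have "Z \<le> L n" if "n \<ge> n0" for n
    proof -
      have "norm z \<le> r n" using n0 rr(1)[of n] that by linarith
      then have "m z \<le> m (w (r n))" using norm_ge_zero[of z] by (intro w(2)) linarith+
      then have "exp Z \<le> exp (L n)" using z unfolding L_def exp\<Lambda> by linarith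
      then show ?thesis by simp
    qed
    then show "eventually (\<lambda>n. Z \<le> L n) sequentially" using eventually_sequentially by blast
  qed
  interpret growth_scale r L
  proof
    show "r n \<ge> 1" for n using rr(1)[of n] by simp
    show "L n \<ge> 1" for n by (simp add: L_def ge1)
  qed (rule L_at_top)
  have m_le: "m z \<le> exp (2 * L n)" if "norm z \<le> r n * (1 + s / L n)" "s < 1" for s n z
  proof -
    have rn: "r n \<ge> 1" and Ln: "L n \<ge> 1" by (rule r, rule L)
    have "s / L n \<le> 1 / L n" using that Ln by (intro divide_right_mono) auto
    then have "r n * (1 + s / L n) \<le> r n * (1 + 1 / L n)" using rn by (intro mult_left_mono) auto
    with that have z: "norm z \<le> r n * (1 + 1 / L n)" by linarith
    then have "m z \<le> m (w (r n * (1 + 1 / L n)))"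
      using norm_ge_zero[of z] by (intro w(2)) linarith+
    also have "\<dots> \<le> exp (\<Lambda> (r n * (1 + 1 / L n)))" unfolding exp\<Lambda> by simp
    also have "\<dots> \<le> exp (2 * L n)" using rr(2)[of n] by (simp add: L_def)
    finally show ?thesis .
  qed
  have sm: "small h" if "h holomorphic_on UNIV" "\<And>z. norm (h z) \<le> m z" for h
  proof (rule smallI)
    fix s :: real assume "0 \<le> s" "s < 1"
    then have "norm (h z) \<le> exp (2 * L n)" if "norm z \<le> r n * (1 + s / L n)" for n z
      using m_le[OF that] \<open>\<And>z. norm (h z) \<le> m z\<close>[of z] by linarith
    then show "\<exists>C\<ge>0. \<forall>n z. norm z \<le> r n * (1 + s / L n) \<longrightarrow> norm (h z) \<le> exp (C * L n)"
      by (intro exI[of _ 2]) auto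
  qed fact
  have "(exp (L n) - 3) / 2 \<le> norm (\<gamma> (w (r n))) \<or> (exp (L n) - 3) / 2 \<le> norm (\<delta> (w (r n)))" for n
    unfolding L_def exp\<Lambda> m_def by auto
  moreover have "norm (w (r n)) \<le> r n" for n using rr(1)[of n] by (intro w(1)) simp
  ultimately have either: "(\<exists>z. norm z \<le> r n \<and> (exp (L n) - 3) / 2 \<le> norm (\<gamma> z)) \<or>
     (\<exists>z. norm z \<le> r n \<and> (exp (L n) - 3) / 2 \<le> norm (\<delta> z))" for n by blast
  have "dominant \<gamma> \<or> dominant \<delta>"
  proof (rule ccontr)
    assume "\<not> ?thesis"
    then have "eventually (\<lambda>n. \<not> (\<exists>z. norm z \<le> r n \<and> (exp (L n) - 3) / 2 \<le> norm (\<gamma> z))) sequentially"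
      "eventually (\<lambda>n. \<not> (\<exists>z. norm z \<le> r n \<and> (exp (L n) - 3) / 2 \<le> norm (\<delta> z))) sequentially"
      using hol by (auto simp: dominant_def not_frequently)
    then have "eventually (\<lambda>n. False) sequentially"
      by eventually_elim (use either in blast)
    then show False by simp
  qed
  moreover have "small \<gamma>" "small \<delta>"
    by (rule sm; simp add: hol m_def)+
  ultimately show ?thesis using that[OF growth_scale_axioms] by blast
qed

text \<open>
  With \<open>F = exp \<circ> \<gamma>\<close>, \<open>G = exp \<circ> \<delta>\<close> the equation is the quadratic relation with \<open>R = F\<^sup>(\<^sup>k\<^sup>) / F\<close> and \<open>S = G\<^sup>(\<^sup>k\<^sup>) / G\<close>, which is
  symmetric in both functions. Once \<open>R = S\<close>, it factors as \<open>(F - G) (F + G + \<eta>) = 0\<close>. If the second factor vanished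
  identically, \<open>F\<close> would omit both 0 and \<open>-\<eta>\<close> and be constant by Picard's little theorem.
\<close>
lemma entire_product_unique:
  fixes F G :: "complex \<Rightarrow> complex"
  assumes hol: "F holomorphic_on UNIV" "G holomorphic_on UNIV"
    and nz: "\<And>z. F z \<noteq> 0" "\<And>z. G z \<noteq> 0" and \<eta>: "\<eta> \<noteq> 0" and k: "k > 0"
    and eq: "\<And>z. (F z + \<eta>) * (deriv ^^ k) F z = (G z + \<eta>) * (deriv ^^ k) G z"
    and F0: "(deriv ^^ k) F \<xi> \<noteq> 0" and G0: "(deriv ^^ k) G \<xi>' \<noteq> 0"
  shows "F = G"
proof -
  obtain \<gamma> where \<gamma>: "\<gamma> holomorphic_on UNIV" "\<And>z. exp (\<gamma> z) = F z"
    using holomorphic_logarithm_exists[OF convex_UNIV open_UNIV hol(1)] nz(1) by (metis UNIV_I)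
  obtain \<delta> where \<delta>: "\<delta> holomorphic_on UNIV" "\<And>z. exp (\<delta> z) = G z"
    using holomorphic_logarithm_exists[OF convex_UNIV open_UNIV hol(2)] nz(2) by (metis UNIV_I)
  have Fe: "F = (\<lambda>z. exp (\<gamma> z))" and Ge: "G = (\<lambda>z. exp (\<delta> z))" using \<gamma> \<delta> by auto
  define R where "R = log_quotient \<gamma> k"
  define S where "S = log_quotient \<delta> k"
  have DF: "(deriv ^^ k) F z = F z * R z" for z unfolding Fe higher_deriv_exp[OF \<gamma>(1)] R_def ..
  have DG: "(deriv ^^ k) G z = G z * S z" for z unfolding Ge higher_deriv_exp[OF \<delta>(1)] S_def ..
  have R0: "R \<xi> \<noteq> 0" and S0: "S \<xi>' \<noteq> 0" using F0 G0 DF DG by auto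
  have log_quotient_const: "log_quotient h k z = 0" if "\<And>z. deriv h z = 0" for h z
  proof -
    have "log_quotient h k = (\<lambda>z. if k = 0 then 1 else 0)"
      by (induction k) (auto simp: that)
    then show ?thesis using k by simp
  qed
  obtain \<zeta> where \<zeta>: "deriv \<gamma> \<zeta> \<noteq> 0" using log_quotient_const R0 unfolding R_def by blast
  obtain \<zeta>' where \<zeta>': "deriv \<delta> \<zeta>' \<noteq> 0" using log_quotient_const S0 unfolding S_def by blast
  have "\<not> \<gamma> constant_on UNIV"
  proof
    assume "\<gamma> constant_on UNIV"
    then obtain c where "\<gamma> = (\<lambda>_. c)" by (auto simp: constant_on_def fun_eq_iff)
    with \<zeta> show False by simp
  qed
  then obtain r L where scale: "growth_scale r L" and sm: "growth_scale.small r L \<gamma>" "growth_scale.small r L \<delta>"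
    and dom: "growth_scale.dominant r L \<gamma> \<or> growth_scale.dominant r L \<delta>"
    using growth_scale_exists[OF \<gamma>(1) \<delta>(1)] by blast
  interpret growth_scale r L by (rule scale)
  have RS: "small R" "small S" unfolding R_def S_def by (intro small_log_quotient sm)+
  have rel: "(exp (\<gamma> z) + \<eta>) * (exp (\<gamma> z) * R z) = (exp (\<delta> z) + \<eta>) * (exp (\<delta> z) * S z)" for z
    using eq[of z] by (simp add: DF DG \<gamma> \<delta>)
  have RS_eq: "R z = S z" for z
    using dom
  proof
    assume "dominant \<gamma>"
    then show ?thesis by (rule quadratic_relation_forces_equality[OF _ RS sm \<eta> rel R0 S0 \<zeta>'])
  next
    assume "dominant \<delta>"
    then have "S z = R z"
      by (rule quadratic_relation_forces_equality[OF _ RS(2,1) sm(2,1) \<eta> rel[symmetric] S0 R0 \<zeta>])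
    then show ?thesis ..
  qed
  have hR: "R holomorphic_on UNIV" by (rule small_holomorphic[OF RS(1)])
  have p1: "R z * ((F z - G z) * (F z + G z + \<eta>)) = 0" for z
    using eq[of z] unfolding DF DG RS_eq[symmetric] by (simp add: algebra_simps)
  have p2: "(F z - G z) * (F z + G z + \<eta>) = 0" for z
    by (rule holomorphic_mult_eq_0[of R "\<lambda>z. (F z - G z) * (F z + G z + \<eta>)", OF _ _ p1 R0])
       (intro holomorphic_intros hol hR)+
  show ?thesis
  proof (rule ccontr)
    assume "F \<noteq> G"
    then obtain x where x: "F x - G x \<noteq> 0" by auto
    have p3: "F z + G z + \<eta> = 0" for z
      by (rule holomorphic_mult_eq_0[of "\<lambda>z. F z - G z" "\<lambda>z. F z + G z + \<eta>", OF _ _ p2 x])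
         (intro holomorphic_intros hol)+
    have "F z \<noteq> - \<eta>" for z using p3[of z] nz(2)[of z] by auto
    then have "range F \<inter> {0, - \<eta>} = {}" using nz(1) by (metis Int_emptyI imageE insertE singletonD)
    then obtain c where "F = (\<lambda>_. c)" using little_Picard[OF hol(1), of 0 "-\<eta>"] \<eta> by auto
    with F0 k show False by simp
  qed
qed

section \<open>Periodicity\<close>

lemma higher_deriv_zero_imp_polynomial:
  fixes f :: "complex \<Rightarrow> complex"
  assumes hol: "f holomorphic_on UNIV" and zero: "\<And>z. (deriv ^^ k) f z = 0"
  shows "\<exists>p. \<forall>z. f z = poly p z"
proof -
  have k0: "(deriv ^^ k) f = (\<lambda>_. 0)" using zero by (simp add: fun_eq_iff)
  have d0: "(deriv ^^ n) f 0 = 0" if "n \<ge> k" for n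
  proof -
    have "(deriv ^^ ((n - k) + k)) f 0 = 0"
      unfolding funpow_add o_def k0 by simp
    then show ?thesis using that by simp
  qed
  define p where "p = (\<Sum>n<k. monom ((deriv ^^ n) f 0 / fact n) n)"
  have "f z = poly p z" for z
  proof -
    have "f holomorphic_on ball 0 (norm z + 1)" using hol holomorphic_on_subset by blast
    then have "(\<lambda>n. (deriv ^^ n) f 0 / fact n * (z - 0) ^ n) sums f z"
      by (rule holomorphic_power_series) simp
    moreover have "(\<lambda>n. (deriv ^^ n) f 0 / fact n * (z - 0) ^ n) sums 
        (\<Sum>n<k. (deriv ^^ n) f 0 / fact n * (z - 0) ^ n)"
      by (rule sums_finite) (use d0 in \<open>auto simp: not_less\<close>)
    ultimately have "f z = (\<Sum>n<k. (deriv ^^ n) f 0 / fact n * (z - 0) ^ n)"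
      using sums_unique2 by blast
    then show ?thesis by (simp add: p_def poly_sum poly_monom)
  qed
  then show ?thesis by blast
qed

text \<open>
  Here \<open>c\<close> itself is a period: \<open>f - \<eta>\<close> and its translate by \<open>c\<close> are zero-free entire functions to which uniqueness applies.
  Transcendence guarantees that \<open>f\<^sup>(\<^sup>k\<^sup>)\<close> does not vanish identically.
\<close>
lemma (in periodic_product) periodic_if_entire:
  assumes np: "\<And>z. \<not> is_pole f z" and trans: "\<not> rational_meromorphic f"
  shows "periodic_meromorphic f"
proof -
  have hol: "f holomorphic_on UNIV"
    by (rule analytic_imp_holomorphic, subst analytic_on_analytic_at) (use analytic_at np in blast)
  have "fn 1 analytic_on UNIV"
    by (subst analytic_on_analytic_at) (use analytic_fn np in blast)
  then have hol1: "fn 1 holomorphic_on UNIV" by (rule analytic_imp_holomorphic)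
  define F where "F z = f z - \<eta>" for z
  define G where "G z = fn 1 z - \<eta>" for z
  have hFG: "F holomorphic_on UNIV" "G holomorphic_on UNIV"
    unfolding F_def G_def by (intro holomorphic_intros hol hol1)+
  have D: "(deriv ^^ k) (\<lambda>z. h z - \<eta>) = (deriv ^^ k) h" if "h holomorphic_on UNIV" for h
    using higher_deriv_diff[OF that, of "\<lambda>_. \<eta>"] k by (auto simp: fun_eq_iff)
  have DF: "(deriv ^^ k) F = (deriv ^^ k) f" and DG: "(deriv ^^ k) G = (deriv ^^ k) (fn 1)"
    unfolding F_def[abs_def] G_def[abs_def] using D hol hol1 by blast+
  obtain \<xi> where \<xi>: "(deriv ^^ k) f \<xi> \<noteq> 0"
  proof (rule ccontr)
    assume "\<not> thesis"
    with that have "\<exists>p. \<forall>z. f z = poly p z" by (intro higher_deriv_zero_imp_polynomial[OF hol]) blast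
    then obtain p where "\<forall>z. f z = poly p z" by blast
    then have "rational_meromorphic f"
      unfolding rational_meromorphic_def by (intro exI[of _ p] exI[of _ 1]) simp
    with trans show False by blast
  qed
  have "F = G"
  proof (rule entire_product_unique[OF hFG _ _ \<eta> k])
    show "F z \<noteq> 0" for z using omit[OF np] by (simp add: F_def)
    show "G z \<noteq> 0" for z using omit[OF np] by (simp add: G_def fn_def)
    show "(F z + \<eta>) * (deriv ^^ k) F z = (G z + \<eta>) * (deriv ^^ k) G z" for z
      using H_fn[OF np, of 1 z] unfolding DF DG by (simp add: F_def G_def H_def)
    show "(deriv ^^ k) F \<xi> \<noteq> 0" unfolding DF by (rule \<xi>)
    show "(deriv ^^ k) G (\<xi> - c) \<noteq> 0" unfolding DG higher_deriv_fn using \<xi> by simp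
  qed
  then have "f (z + c) = f z" for z
    by (simp add: fun_eq_iff F_def G_def fn_def)
  then show ?thesis
    unfolding periodic_meromorphic_def using c by (intro exI[of _ c]) simp
qed

theorem theorem1p1:
  fixes f :: "complex \<Rightarrow> complex" and k :: nat
  assumes "transcendental_meromorphic f"
    and "\<exists>\<eta>. \<eta> \<noteq> 0 \<and> picard_exceptional_value f \<eta>"
    and "k > 0"
    and "periodic_meromorphic (\<lambda>z. f z * (deriv ^^ k) f z)"
  shows "periodic_meromorphic f"
proof -
  obtain \<eta> where \<eta>: "\<eta> \<noteq> 0" "\<And>z. \<not> is_pole f z \<Longrightarrow> f z \<noteq> \<eta>"
    using assms(2) by (auto simp: picard_exceptional_value_def)
  obtain c where c: "c \<noteq> 0" "\<forall>\<^sub>\<approx>z. f (z + c) * (deriv ^^ k) f (z + c) = f z * (deriv ^^ k) f z"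
    using assms(4) by (auto simp: periodic_meromorphic_def)
  have f: "f nicely_meromorphic_on UNIV" "\<not> rational_meromorphic f"
    using assms(1) by (auto simp: transcendental_meromorphic_def)
  interpret periodic_product f k c \<eta>
    by unfold_locales (use f \<eta> c assms(3) in auto)
  show ?thesis
  proof (cases "\<exists>z. is_pole f z")
    case True
    then show ?thesis using periodic_if_pole by blast
  next
    case False
    then show ?thesis using periodic_if_entire f(2) by blast
  qed
qed

end
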